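(* Let $K$ be a commutative $\mathbb{Q}$-algebra, $D$ a set, and for each $d\in D$ let $F_d(\rho)=\sum_{n\ge0}c_{n,d}\rho^{n-1}$ be a formal Laurent series. Define operators $\Lambda^{(d)}$ on $K[L]$ by $\Lambda^{(d)}p(L)=p(\partial_\rho)(e^{L\rho}-1)F_d(\rho)|_{\rho=0}$. Let $\phi:\mathcal{H}(D)\to K[L]$ be the unique algebra morphism with $\phi\circ B_+^{(d)}=\Lambda^{(d)}\circ\phi$ for all $d\in D$. Then for every $D$-decorated rooted tree $t$, \[ \phi(t)=\sum_{\tau\in\mathrm{Tub}(t)}c(\tau)\sum_{i=1}^{b(\tau)}c_{b(\tau)-i,\,d(\operatorname{rt}(t))}\frac{L^i}{i!}. \]
   Context: A rooted tree is a root vertex with a possibly empty multiset of rooted trees as children; a $D$-decorated rooted tree has a decoration $d(v)\in D$ at each vertex. $\mathcal{H}(D)$ is the free commutative $K$-algebra generated by $D$-decorated rooted trees (basis: forests, the empty forest being $1$). $B_+^{(d)}$ is the linear operator sending a forest to the tree obtained by adding a new root decorated $d$ adjacent to the roots of all components ($B_+^{(d)}(1)$ is the one-vertex tree decorated $d$). A tube of $t$ is a set of vertices inducing a connected subgraph; a binary tubing $\tau$ of $t$ is a set of tubes containing $V(t)$ such that every tube is a single vertex or is partitioned by two other tubes of $\tau$; $\mathrm{Tub}(t)$ is the set of these. $b(v,\tau)$ is the number of tubes of $\tau$ whose root (vertex nearest $\operatorname{rt}(t)$) is $v$; $b(\tau)=b(\operatorname{rt}(t),\tau)$. The Mellin monomial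 is $c(\tau)=\prod_{v\ne\operatorname{rt}(t)}c_{b(v,\tau)-1,\,d(v)}$.
   Formalization: Binary tubings are additionally required to have any two tubes nested or disjoint; without this the path a-b-c rooted at a would have the extra tubing {abc, ab, bc, a, b, c} and the formula would fail. *)

theory Defs
  imports
    "HOL-Library.Multiset"
    "HOL-Library.Poly_Mapping"
    "HOL-Computational_Algebra.Formal_Laurent_Series"
    "HOL-Computational_Algebra.Polynomial"
begin

text \<open>Commutative \<open>\<rat>\<close>-algebras, in the style of the library class \<open>real_algebra_1\<close>.\<close>

class comm_rat_algebra_1 = comm_ring_1 +
  fixes scaleQ :: "rat \<Rightarrow> 'a \<Rightarrow> 'a"
  assumes scaleQ_add_right: "scaleQ a (x + y) = scaleQ a x + scaleQ a y"
    and scaleQ_add_left: "scaleQ (a + b) x = scaleQ a x + scaleQ b x"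
    and scaleQ_scaleQ: "scaleQ a (scaleQ b x) = scaleQ (a * b) x"
    and scaleQ_one: "scaleQ 1 x = x"
    and mult_scaleQ_left: "scaleQ a x * y = scaleQ a (x * y)"

definition divided_power :: "nat \<Rightarrow> 'k::comm_rat_algebra_1 poly"  \<comment> \<open>\<open>L\<^sup>n / n!\<close>\<close>
  where "divided_power n = monom (scaleQ (1 / fact n) 1) n"


subsection \<open>Rooted trees\<close>

datatype 'a rtree = Node (root: 'a) (children: "'a rtree multiset")

primrec verts_mset :: "'v rtree \<Rightarrow> 'v multiset" where
  "verts_mset (Node v ts) = add_mset v (\<Sum>\<^sub># (image_mset verts_mset ts))"

text \<open>
  A tree with named vertices is an element \<open>T\<close> of \<^typ>\<open>'v rtree\<close> in which no vertex name is repeated.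
  Together with a decoration \<open>dec :: 'v \<Rightarrow> 'd\<close> of its vertices it represents the \<open>'d\<close>-decorated
  rooted tree \<open>map_rtree dec T\<close>, in which only the multisets of decorated subtrees are remembered.
\<close>

definition distinct_verts :: "'v rtree \<Rightarrow> bool" where
  "distinct_verts T \<longleftrightarrow> (\<forall>v. count (verts_mset T) v \<le> 1)"

abbreviation verts :: "'v rtree \<Rightarrow> 'v set" where
  "verts T \<equiv> set_rtree T"

primrec arcs :: "'v rtree \<Rightarrow> ('v \<times> 'v) set" where  \<comment> \<open>(parent, child) pairs\<close>
  "arcs (Node v ts) = (\<lambda>s. (v, root s)) ` set_mset ts \<union> \<Union> (set_mset (image_mset arcs ts))"

definition adj :: "'v rtree \<Rightarrow> ('v \<times> 'v) set" where
  "adj T = arcs T \<union> (arcs T)\<inverse>"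

definition root_dist :: "'v rtree \<Rightarrow> 'v \<Rightarrow> nat" where
  "root_dist T v = (LEAST n. (root T, v) \<in> adj T ^^ n)"


subsection \<open>Binary tubings\<close>

definition tube :: "'v rtree \<Rightarrow> 'v set \<Rightarrow> bool" where
  "tube T X \<longleftrightarrow> X \<noteq> {} \<and> X \<subseteq> verts T \<and> (\<forall>u\<in>X. \<forall>v\<in>X. (u, v) \<in> (Restr (adj T) X)\<^sup>*)"

text \<open>
  As always for tubings, any two tubes are nested or disjoint.  This does not follow from the
  partition condition: on a path \<open>a - b - c\<close> all six connected vertex sets together satisfy the latter.
\<close>

definition binary_tubing :: "'v rtree \<Rightarrow> 'v set set \<Rightarrow> bool" where
  "binary_tubing T \<tau> \<longleftrightarrow>
     (\<forall>X\<in>\<tau>. tube T X) \<and>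
     verts T \<in> \<tau> \<and>
     (\<forall>X\<in>\<tau>. \<forall>Y\<in>\<tau>. X \<subseteq> Y \<or> Y \<subseteq> X \<or> X \<inter> Y = {}) \<and>
     (\<forall>X\<in>\<tau>. is_singleton X \<or> (\<exists>Y\<in>\<tau>. \<exists>Z\<in>\<tau>. Y \<union> Z = X \<and> Y \<inter> Z = {}))"

definition Tub :: "'v rtree \<Rightarrow> 'v set set set" where
  "Tub T = {\<tau>. binary_tubing T \<tau>}"

definition tube_root :: "'v rtree \<Rightarrow> 'v set \<Rightarrow> 'v" where
  "tube_root T X = arg_min_on (root_dist T) X"

definition tube_count :: "'v rtree \<Rightarrow> 'v \<Rightarrow> 'v set set \<Rightarrow> nat" where  \<comment> \<open>\<open>b(v,\<tau>)\<close>\<close>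
  "tube_count T v \<tau> = card {X \<in> \<tau>. tube_root T X = v}"

definition mellin_monomial ::
  "(nat \<Rightarrow> 'd \<Rightarrow> 'k::comm_monoid_mult) \<Rightarrow> 'v rtree \<Rightarrow> ('v \<Rightarrow> 'd) \<Rightarrow> 'v set set \<Rightarrow> 'k" where
  "mellin_monomial c T dec \<tau> = (\<Prod>v \<in> verts T - {root T}. c (tube_count T v \<tau> - 1) (dec v))"


subsection \<open>The algebra of decorated forests\<close>

text \<open>
  Forests are finite multisets of trees, and products of forests are disjoint unions; hence the free
  commutative algebra on the trees is the monoid algebra of the additive monoid of these multisets.
\<close>

type_synonym ('d, 'k) forest_algebra = "'d rtree multiset \<Rightarrow>\<^sub>0 'k"

definition forest :: "'d rtree multiset \<Rightarrow> ('d, 'k::comm_ring_1) forest_algebra" where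
  "forest f = Poly_Mapping.single f 1"

definition B_plus :: "'d \<Rightarrow> ('d, 'k::comm_ring_1) forest_algebra \<Rightarrow> ('d, 'k) forest_algebra" where
  "B_plus d x = (\<Sum>f\<in>Poly_Mapping.keys x. Poly_Mapping.single {#Node d f#} (Poly_Mapping.lookup x f))"

definition algebra_morphism :: "(('d, 'k::comm_ring_1) forest_algebra \<Rightarrow> 'k poly) \<Rightarrow> bool" where
  "algebra_morphism \<phi> \<longleftrightarrow>
     (\<forall>a. \<phi> (Poly_Mapping.single 0 a) = [:a:]) \<and>
     (\<forall>x y. \<phi> (x + y) = \<phi> x + \<phi> y) \<and>
     (\<forall>x y. \<phi> (x * y) = \<phi> x * \<phi> y)"


subsection \<open>The operators on polynomials\<close>

text \<open>
  Laurent series in \<open>\<rho>\<close> have coefficients in \<open>K[L]\<close>, and \<open>K\<close> is embedded there as the constants.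
  For \<open>p = \<Sum>\<^sub>k a\<^sub>k L\<^sup>k\<close> the operator \<open>p(\<partial>\<^sub>\<rho>)\<close> is \<open>\<Sum>\<^sub>k a\<^sub>k \<partial>\<^sub>\<rho>\<^sup>k\<close>; it does not act on the \<open>L\<close> in \<open>e\<^sup>L\<^sup>\<rho>\<close>.
  The series it is applied to has no polar part, so evaluation at \<open>0\<close> is the constant coefficient.
\<close>

definition mellin_series :: "(nat \<Rightarrow> 'd \<Rightarrow> 'k::comm_rat_algebra_1) \<Rightarrow> 'd \<Rightarrow> 'k poly fls" where
  "mellin_series c d = fls_shift 1 (fps_to_fls (Abs_fps (\<lambda>n. [:c n d:])))"  \<comment> \<open>\<open>\<Sum>\<^sub>n c\<^sub>n\<^sub>,\<^sub>d \<rho>\<^sup>n\<^sup>-\<^sup>1\<close>\<close>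

definition exp_L_rho :: "'k::comm_rat_algebra_1 poly fls" where
  "exp_L_rho = fps_to_fls (Abs_fps divided_power)"

definition Lam :: "(nat \<Rightarrow> 'd \<Rightarrow> 'k::comm_rat_algebra_1) \<Rightarrow> 'd \<Rightarrow> 'k poly \<Rightarrow> 'k poly" where
  "Lam c d p = (\<Sum>k\<le>degree p.
     smult (coeff p k) (fls_nth ((fls_deriv ^^ k) ((exp_L_rho - 1) * mellin_series c d)) 0))"


subsection \<open>Well-definedness\<close>

text \<open>Every decorated rooted tree arises from a tree with named vertices.\<close>

lemma ex_named_tree:
  fixes t :: "'d rtree"
  shows "\<exists>T :: (nat \<times> 'd) rtree. distinct_verts T \<and> t = map_rtree snd T"
proof -
  have "\<exists>(T :: (nat \<times> 'd) rtree) m. map_rtree snd T = t \<and> distinct_verts T \<and> n \<le> m \<and>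
          (\<forall>v\<in>#verts_mset T. n \<le> fst v \<and> fst v < m)" for n
  proof (induction t arbitrary: n)
    case (Node d ts)
    have "\<exists>(Ts :: (nat \<times> 'd) rtree multiset) m. image_mset (map_rtree snd) Ts = M \<and>
            (\<forall>v. count (\<Sum>\<^sub># (image_mset verts_mset Ts)) v \<le> 1) \<and> n \<le> m \<and>
            (\<forall>v\<in>#\<Sum>\<^sub># (image_mset verts_mset Ts). n \<le> fst v \<and> fst v < m)"
      if "set_mset M \<subseteq> set_mset ts" for M n
      using that
    proof (induction M arbitrary: n)
      case empty
      show ?case by (intro exI[of _ "{#}"] exI[of _ n]) simp
    next
      case (add s M)
      have "s \<in># ts" "set_mset M \<subseteq> set_mset ts" using add.prems by auto
      from Node.IH[OF this(1), of n] obtain S m1 where S: "map_rtree snd S = s"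
        "distinct_verts S" "n \<le> m1" "\<forall>v\<in>#verts_mset S. n \<le> fst v \<and> fst v < m1" by blast
      from add.IH[OF \<open>set_mset M \<subseteq> set_mset ts\<close>, of m1] obtain Ts m2 where
        Ts: "image_mset (map_rtree snd) Ts = M"
        "\<forall>v. count (\<Sum>\<^sub># (image_mset verts_mset Ts)) v \<le> 1" "m1 \<le> m2"
        "\<forall>v\<in>#\<Sum>\<^sub># (image_mset verts_mset Ts). m1 \<le> fst v \<and> fst v < m2" by blast
      have "count (verts_mset S) v + count (\<Sum>\<^sub># (image_mset verts_mset Ts)) v \<le> 1" for v
      proof (cases "fst v < m1")
        case True
        hence "v \<notin># \<Sum>\<^sub># (image_mset verts_mset Ts)" using Ts(4) by (meson not_less)
        hence "count (\<Sum>\<^sub># (image_mset verts_mset Ts)) v = 0" by (simp only: not_in_iff)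
        thus ?thesis using S(2) by (cases v) (simp add: distinct_verts_def)
      next
        case False
        hence "v \<notin># verts_mset S" using S(4) by blast
        hence "count (verts_mset S) v = 0" by (simp only: not_in_iff)
        thus ?thesis using Ts(2) by (cases v) simp
      qed
      moreover have "\<forall>v\<in>#verts_mset S + \<Sum>\<^sub># (image_mset verts_mset Ts). n \<le> fst v \<and> fst v < m2"
        using S(3,4) Ts(3,4) by (metis order_trans order_less_le_trans union_iff)
      ultimately show ?case
        using S(1,3) Ts(1,3) by (intro exI[of _ "add_mset S Ts"] exI[of _ m2]) auto
    qed
    from this[OF subset_refl, of n] obtain Ts :: "(nat \<times> 'd) rtree multiset" and m where
      Ts: "image_mset (map_rtree snd) Ts = ts"
      "\<forall>v. count (\<Sum>\<^sub># (image_mset verts_mset Ts)) v \<le> 1" "n \<le> m"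
      "\<forall>v\<in>#\<Sum>\<^sub># (image_mset verts_mset Ts). n \<le> fst v \<and> fst v < m" by blast
    have "(m, d) \<notin># \<Sum>\<^sub># (image_mset verts_mset Ts)" using Ts(4) by fastforce
    hence "count (\<Sum>\<^sub># (image_mset verts_mset Ts)) (m, d) = 0" by (simp only: not_in_iff)
    hence "distinct_verts (Node (m, d) Ts)" using Ts(2) by (simp add: distinct_verts_def)
    moreover have "\<forall>v\<in>#verts_mset (Node (m, d) Ts). n \<le> fst v \<and> fst v < Suc m"
      using Ts(3,4) by (metis fst_conv insert_iff less_Suc_eq set_mset_add_mset_insert verts_mset.simps)
    ultimately show ?case
      using Ts(1,3) by (intro exI[of _ "Node (m, d) Ts"] exI[of _ "Suc m"]) simp
  qed
  from this[of 0] show ?thesis by blast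
qed

lemma Lam_altdef:
  assumes "degree p \<le> n"
  shows "Lam c d p = (\<Sum>k\<le>n.
     smult (coeff p k) (fls_nth ((fls_deriv ^^ k) ((exp_L_rho - 1) * mellin_series c d)) 0))"
  unfolding Lam_def
  by (rule sum.mono_neutral_left) (use assms in \<open>auto simp: coeff_eq_0\<close>)

lemma Lam_add: "Lam c d (p + q) = Lam c d p + Lam c d q"
  using degree_add_le_max[of p q]
  by (simp add: Lam_altdef[where n = "max (degree p) (degree q)"] smult_add_left sum.distrib)

lemma smult_sum_right: "smult a (\<Sum>i\<in>I. f i) = (\<Sum>i\<in>I. smult a (f i))"
  by (induction I rule: infinite_finite_induct) (auto simp: smult_add_right)

lemma Lam_smult: "Lam c d (smult a p) = smult a (Lam c d p)"
  by (simp add: Lam_altdef[OF degree_smult_le] Lam_def[of c d p] smult_sum_right)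

lemma Lam_0: "Lam c d 0 = 0"
  by (simp add: Lam_def)

lemma Lam_sum: "Lam c d (\<Sum>i\<in>I. f i) = (\<Sum>i\<in>I. Lam c d (f i))"
  by (induction I rule: infinite_finite_induct) (auto simp: Lam_0 Lam_add)

lemma poly_mapping_sum_single:
  "x = (\<Sum>k\<in>Poly_Mapping.keys x. Poly_Mapping.single k (Poly_Mapping.lookup x k))"
  by (rule poly_mapping_eqI)
     (simp add: lookup_sum lookup_single when_def in_keys_iff)

lemma poly_mapping_single_induct [case_names zero single add]:
  fixes x :: "'a \<Rightarrow>\<^sub>0 'b::comm_monoid_add"
  assumes "P 0" "\<And>k a. P (Poly_Mapping.single k a)" "\<And>x y. P x \<Longrightarrow> P y \<Longrightarrow> P (x + y)"
  shows "P x"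
proof -
  have "P (\<Sum>k\<in>I. Poly_Mapping.single k (Poly_Mapping.lookup x k))" for I
    by (induction I rule: infinite_finite_induct) (auto intro: assms)
  thus ?thesis using poly_mapping_sum_single[of x] by metis
qed

primrec phi_tree :: "(nat \<Rightarrow> 'd \<Rightarrow> 'k::comm_rat_algebra_1) \<Rightarrow> 'd rtree \<Rightarrow> 'k poly" where
  "phi_tree c (Node d ts) = Lam c d (\<Prod>\<^sub># (image_mset (phi_tree c) ts))"

lemma mellin_morphism_unique:
  assumes "algebra_morphism \<phi>" "\<forall>d. \<phi> \<circ> B_plus d = Lam c d \<circ> \<phi>"
  shows "\<phi> x = (\<Sum>f\<in>Poly_Mapping.keys x.
           smult (Poly_Mapping.lookup x f) (\<Prod>\<^sub># (image_mset (phi_tree c) f)))"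
proof -
  have const: "\<phi> (Poly_Mapping.single 0 a) = [:a:]" and add: "\<phi> (x + y) = \<phi> x + \<phi> y"
    and mult: "\<phi> (x * y) = \<phi> x * \<phi> y" and B: "\<phi> (B_plus d x) = Lam c d (\<phi> x)" for a x y d
    using assms by (auto simp: algebra_morphism_def fun_eq_iff)
  have one: "\<phi> (forest {#}) = 1"
    using const[of 1] by (simp add: forest_def one_pCons)
  have forest: "\<phi> (forest f) = \<Prod>\<^sub># (image_mset (\<lambda>t. \<phi> (forest {#t#})) f)" for f
  proof (induction f)
    case (add t f)
    have "forest (add_mset t f) = (forest {#t#} :: ('a, 'b) forest_algebra) * forest f"
      by (simp add: forest_def mult_single)
    thus ?case using add by (simp add: mult)
  qed (simp add: one)
  have tree: "\<phi> (forest {#t#}) = phi_tree c t" for t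
  proof (induction t)
    case (Node d ts)
    have "forest {#Node d ts#} = (B_plus d (forest ts) :: ('a, 'b) forest_algebra)"
      by (simp add: forest_def B_plus_def)
    hence "\<phi> (forest {#Node d ts#}) = Lam c d (\<phi> (forest ts))"
      by (simp add: B)
    also have "\<phi> (forest ts) = \<Prod>\<^sub># (image_mset (phi_tree c) ts)"
      using Node by (simp add: forest[of ts] cong: image_mset_cong)
    finally show ?case by simp
  qed
  have single: "\<phi> (Poly_Mapping.single f a) = smult a (\<Prod>\<^sub># (image_mset (phi_tree c) f))" for f a
  proof -
    have "Poly_Mapping.single f a = Poly_Mapping.single 0 a * forest f"
      by (simp add: forest_def mult_single)
    thus ?thesis by (simp add: mult const forest[of f] tree)
  qed
  have zero: "\<phi> 0 = 0"
    using const[of 0] by simp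
  have "\<phi> (\<Sum>k\<in>I. g k) = (\<Sum>k\<in>I. \<phi> (g k))" for g and I :: "'a rtree multiset set"
    by (induction I rule: infinite_finite_induct) (auto simp: zero add)
  from this[of "\<lambda>k. Poly_Mapping.single k (Poly_Mapping.lookup x k)" "Poly_Mapping.keys x"]
  show ?thesis
    by (simp add: single flip: poly_mapping_sum_single)
qed

lemma ex1_mellin_morphism:
  fixes c :: "nat \<Rightarrow> 'd \<Rightarrow> 'k::comm_rat_algebra_1"
  shows "\<exists>!\<phi>. algebra_morphism \<phi> \<and> (\<forall>d. \<phi> \<circ> B_plus d = Lam c d \<circ> \<phi>)"
proof -
  define P where "P f = \<Prod>\<^sub># (image_mset (phi_tree c) f)" for f
  define \<phi> where "\<phi> x = (\<Sum>f\<in>Poly_Mapping.keys x. smult (Poly_Mapping.lookup x f) (P f))" for x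
  have single: "\<phi> (Poly_Mapping.single f a) = smult a (P f)" for f a
    by (simp add: \<phi>_def)
  have zero: "\<phi> 0 = 0"
    by (simp add: \<phi>_def)
  have add: "\<phi> (x + y) = \<phi> x + \<phi> y" for x y
    unfolding \<phi>_def by (rule setsum_keys_plus_distrib) (auto simp: smult_add_left)
  have sum: "\<phi> (\<Sum>k\<in>I. g k) = (\<Sum>k\<in>I. \<phi> (g k))" for g and I :: "'d rtree multiset set"
    by (induction I rule: infinite_finite_induct) (auto simp: zero add)
  have P_add: "P (f + g) = P f * P g" for f g
    by (simp add: P_def)
  have mult1: "\<phi> (Poly_Mapping.single f a * y) = \<phi> (Poly_Mapping.single f a) * \<phi> y" for f a y
  proof (induction y rule: poly_mapping_single_induct)
    case (add x y)
    thus ?case by (simp only: distrib_left \<open>\<And>x y. \<phi> (x + y) = \<phi> x + \<phi> y\<close>)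
  qed (simp_all add: zero mult_single single P_add mult_ac)
  have mult: "\<phi> (x * y) = \<phi> x * \<phi> y" for x y
    by (induction x rule: poly_mapping_single_induct)
       (simp_all add: zero mult1 add distrib_right)
  have B: "\<phi> (B_plus d x) = Lam c d (\<phi> x)" for d x
    by (simp add: B_plus_def sum single \<phi>_def[of x] Lam_sum Lam_smult) (simp add: P_def)
  have const: "\<phi> (Poly_Mapping.single 0 a) = [:a:]" for a
    by (simp add: single P_def)
  have "algebra_morphism \<phi> \<and> (\<forall>d. \<phi> \<circ> B_plus d = Lam c d \<circ> \<phi>)"
    by (auto simp: algebra_morphism_def const add mult B)
  moreover have "\<psi> = \<phi>" if "algebra_morphism \<psi> \<and> (\<forall>d. \<psi> \<circ> B_plus d = Lam c d \<circ> \<psi>)" for \<psi>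
  proof
    fix x
    show "\<psi> x = \<phi> x"
      unfolding \<phi>_def P_def using that by (intro mellin_morphism_unique) auto
  qed
  ultimately show ?thesis by blast
qed

end

theory Submission
  imports Defs "HOL-Computational_Algebra.Polynomial_FPS"
begin

text \<open>
  In the basis of divided powers \<open>\<Lambda>\<^sup>(\<^sup>d\<^sup>)\<close> sends \<open>L\<^sup>k/k!\<close> to \<open>\<Sum>\<^sub>i c\<^sub>k\<^sub>+\<^sub>1\<^sub>-\<^sub>i\<^sub>,\<^sub>d L\<^sup>i/i!\<close>, summed over \<open>1 \<le> i \<le> k+1\<close>.
  So the theorem amounts to the claim that, for a tree with root branches \<open>t\<^sub>1, \<dots>, t\<^sub>n\<close>, the product
  \<open>\<phi>(t\<^sub>1) \<cdots> \<phi>(t\<^sub>n)\<close> equals the sum of \<open>c(\<tau>) L\<^sup>b\<^sup>-\<^sup>1/(b-1)!\<close> over all binary tubings \<open>\<tau>\<close>, where \<open>b = b(\<tau>)\<close>.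
  Both sides have the same constant term and satisfy the same differential equation in \<open>L\<close>: the derivative
  is the sum over all edges of the polynomial of the upper part, times the linear coefficient of \<open>\<phi>\<close> of the
  lower part.  For the tubings this holds because the two maximal proper tubes arise by deleting
  an edge, and the upper one carries one root tube less.  For \<open>\<phi>\<close> it is the renormalisation
  group equation, which follows from \<open>(\<Lambda>p)' = (\<Lambda>p)'(0) + \<Lambda>(p')\<close>.
\<close>

subsection \<open>Derivatives and divided powers\<close>

text \<open>The library's \<^const>\<open>pderiv\<close> requires a coefficient ring without zero divisors.\<close>

definition poly_deriv :: "'a::comm_ring_1 poly \<Rightarrow> 'a poly" where
  "poly_deriv p = Abs_poly (\<lambda>n. of_nat (Suc n) * coeff p (Suc n))"

lemma coeff_poly_deriv: "coeff (poly_deriv p) n = of_nat (Suc n) * coeff p (Suc n)"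
  unfolding poly_deriv_def
  by (subst coeff_Abs_poly[where n = "degree p"]) (auto simp: coeff_eq_0)

lemma fps_of_poly_poly_deriv: "fps_of_poly (poly_deriv p) = fps_deriv (fps_of_poly p)"
  by (rule fps_ext) (simp add: coeff_poly_deriv)

lemma poly_deriv_add: "poly_deriv (p + q) = poly_deriv p + poly_deriv q"
  by (simp add: poly_eq_iff coeff_poly_deriv distrib_left)

lemma poly_deriv_smult: "poly_deriv (smult a p) = smult a (poly_deriv p)"
  by (simp add: poly_eq_iff coeff_poly_deriv mult.left_commute)

lemma poly_deriv_0: "poly_deriv 0 = 0"
  by (simp add: poly_eq_iff coeff_poly_deriv)

lemma poly_deriv_const: "poly_deriv [:a:] = 0"
  by (simp add: poly_eq_iff coeff_poly_deriv)

lemma poly_deriv_sum: "poly_deriv (\<Sum>i\<in>I. f i) = (\<Sum>i\<in>I. poly_deriv (f i))"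
  by (induction I rule: infinite_finite_induct) (auto simp: poly_deriv_0 poly_deriv_add)

text \<open>Polynomials embed into formal power series, where the product rule holds over every
  commutative ring.\<close>

lemma poly_deriv_mult: "poly_deriv (p * q) = p * poly_deriv q + poly_deriv p * q"
  by (simp flip: fps_of_poly_eq_iff add: fps_of_poly_poly_deriv fps_of_poly_mult fps_of_poly_add)

text \<open>For \<open>s\<close> in \<open>M\<close>, removing one copy of \<open>s\<close> commutes
  with adding \<open>x\<close>, even if \<open>s = x\<close>. This is the induction step for the
  product rule, where repeated factors count with multiplicity.\<close>

lemma sum_mset_remove_add:
  fixes g :: "'a \<Rightarrow> 'a multiset \<Rightarrow> 'b::comm_monoid_add"
  shows "(\<Sum>s\<in>#add_mset x M. g s (add_mset x M - {#s#})) =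
   g x M + (\<Sum>s\<in>#M. g s (add_mset x (M - {#s#})))"
  by (simp, rule arg_cong[where f = "\<lambda>u. g x M + \<Sum>\<^sub># u"], rule image_mset_cong)
     (simp add: add_mset_diff_bothsides)

lemma poly_deriv_prod_mset:
  "poly_deriv (\<Prod>s\<in>#M. f s) = (\<Sum>s\<in>#M. poly_deriv (f s) * (\<Prod>u\<in>#M - {#s#}. f u))"
proof (induction M)
  case empty
  show ?case by (simp add: one_pCons poly_deriv_const)
next
  case (add x M)
  have "poly_deriv (\<Prod>s\<in>#add_mset x M. f s) = poly_deriv (f x) * (\<Prod>u\<in>#M. f u) +
      f x * (\<Sum>s\<in>#M. poly_deriv (f s) * (\<Prod>u\<in>#M - {#s#}. f u))"
    by (simp add: poly_deriv_mult add)
  also have "f x * (\<Sum>s\<in>#M. poly_deriv (f s) * (\<Prod>u\<in>#M - {#s#}. f u)) =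
      (\<Sum>s\<in>#M. poly_deriv (f s) * (\<Prod>u\<in>#add_mset x (M - {#s#}). f u))"
    by (simp add: sum_mset_distrib_left mult.left_commute)
  finally show ?case
    using sum_mset_remove_add[of "\<lambda>s N. poly_deriv (f s) * (\<Prod>u\<in>#N. f u)" x M] by simp
qed

section \<open>Rational scalars, uniqueness of antiderivatives and divided powers\<close>

lemma scaleQ_of_nat: "scaleQ (of_nat n) (x::'a::comm_rat_algebra_1) = of_nat n * x"
proof (induction n)
  case 0 show ?case using scaleQ_add_left[of 0 0 x] by simp
qed (simp add: scaleQ_add_left scaleQ_one distrib_right)

lemma of_nat_mult_scaleQ: "of_nat n * scaleQ a (x::'a::comm_rat_algebra_1) = scaleQ (of_nat n * a) x"
  by (simp add: scaleQ_scaleQ flip: scaleQ_of_nat)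

text \<open>In a \<rat>-algebra, multiplication by a positive integer is undone by a rational
  scalar. This is what lets a derivative determine the higher coefficients of a polynomial.\<close>

lemma of_nat_mult_cancel:
  fixes x y :: "'a::comm_rat_algebra_1"
  assumes "of_nat (Suc n) * x = of_nat (Suc n) * y"
  shows "x = y"
proof -
  have "scaleQ (1 / of_nat (Suc n)) (scaleQ (of_nat (Suc n)) x) = scaleQ (1 / of_nat (Suc n)) (scaleQ (of_nat (Suc n)) y)"
    using assms by (simp only: scaleQ_of_nat)
  thus ?thesis by (simp add: scaleQ_scaleQ scaleQ_one del: of_nat_Suc)
qed

lemma poly_eq_if_poly_deriv_eq:
  fixes p q :: "'a::comm_rat_algebra_1 poly"
  assumes "poly_deriv p = poly_deriv q" "coeff p 0 = coeff q 0"
  shows "p = q"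
proof (rule poly_eqI)
  fix n show "coeff p n = coeff q n"
  proof (cases n)
    case (Suc m)
    have "coeff (poly_deriv p) m = coeff (poly_deriv q) m" using assms by simp
    thus ?thesis unfolding coeff_poly_deriv Suc by (rule of_nat_mult_cancel)
  qed (use assms in simp)
qed

lemma coeff_divided_power: "coeff (divided_power n) k = (if k = n then scaleQ (1 / fact n) 1 else 0)"
  by (simp add: divided_power_def)

lemma divided_power_0: "divided_power 0 = 1"
  by (simp add: divided_power_def scaleQ_one monom_0)

lemma poly_deriv_divided_power_Suc: "poly_deriv (divided_power (Suc n)) = (divided_power n :: 'a::comm_rat_algebra_1 poly)"
  by (rule poly_eqI) (simp add: coeff_poly_deriv coeff_divided_power of_nat_mult_scaleQ del: of_nat_Suc)

lemma poly_deriv_divided_power_0: "poly_deriv (divided_power 0 :: 'a::comm_rat_algebra_1 poly) = 0"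
  by (simp add: divided_power_0 one_pCons poly_deriv_const)

section \<open>The operators \<open>Lam\<close> in the basis of divided powers\<close>

text \<open>This is the inner sum of the theorem for b(\<tau>) = \<open>b\<close> and, for
  \<open>b > 0\<close>, the image under \<open>Lam c d\<close> of the divided power of index
  \<open>b - 1\<close>.\<close>

definition mellin_poly :: "(nat \<Rightarrow> 'd \<Rightarrow> 'k::comm_rat_algebra_1) \<Rightarrow> 'd \<Rightarrow> nat \<Rightarrow> 'k poly" where
  "mellin_poly c d b = (\<Sum>i=1..b. smult (c (b - i) d) (divided_power i))"

lemma coeff_0_mellin_poly: "coeff (mellin_poly c d b) 0 = 0"
  by (simp add: mellin_poly_def coeff_sum coeff_divided_power)

lemma coeff_1_mellin_poly: "b > 0 \<Longrightarrow> coeff (mellin_poly c d b) 1 = c (b - 1) d"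
  by (simp add: mellin_poly_def coeff_sum coeff_divided_power if_distrib[of "(*) _"] scaleQ_one cong: if_cong)

text \<open>The factor 1/\<rho> shifts the Cauchy product by one place, hence \<open>Suc k\<close>.
  Subtracting 1 from the exponential series removes the summand \<open>i = 0\<close>.\<close>

lemma fls_nth_mellin_product:
  "fls_nth ((exp_L_rho - 1) * mellin_series c d) (int k) = mellin_poly c d (Suc k)"
proof -
  have "(exp_L_rho - 1) * mellin_series c d =
    fls_shift 1 (fps_to_fls ((Abs_fps divided_power - 1) * Abs_fps (\<lambda>n. [:c n d:])))"
    by (simp add: exp_L_rho_def mellin_series_def fls_shifted_times_simps fls_times_fps_to_fls)
  hence "fls_nth ((exp_L_rho - 1) * mellin_series c d) (int k) =
     ((Abs_fps divided_power - 1) * Abs_fps (\<lambda>n. [:c n d:])) $ Suc k"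
    by (simp add: nat_add_distrib)
  also have "\<dots> = (\<Sum>i=0..Suc k. (divided_power i - (if i = 0 then 1 else 0)) * [:c (Suc k - i) d:])"
    by (simp add: fps_mult_nth)
  also have "\<dots> = (\<Sum>i=1..Suc k. (divided_power i - (if i = 0 then 1 else 0)) * [:c (Suc k - i) d:])"
    by (rule sum.mono_neutral_right) (auto simp: divided_power_0 not_less_eq_eq)
  also have "\<dots> = mellin_poly c d (Suc k)"
    unfolding mellin_poly_def by (rule sum.cong) auto
  finally show ?thesis .
qed

lemma fls_nth_higher_deriv_0:
  fixes f :: "'a::comm_ring_1 fls"
  shows "fls_nth ((fls_deriv ^^ k) f) 0 = of_nat (fact k) * fls_nth f (int k)"
proof -
  \<comment> \<open>Each derivative reads the coefficient one place higher, so the induction has to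
    cover all exponents \<open>m\<close>.\<close>
  have "fls_nth ((fls_deriv ^^ k) f) (int m) = of_nat (\<Prod>j=1..k. m + j) * fls_nth f (int (m + k))" for m
  proof (induction k arbitrary: m)
    case (Suc k)
    have "int m + 1 = int (Suc m)" by simp
    hence "fls_nth ((fls_deriv ^^ Suc k) f) (int m) = of_int (int (Suc m)) * fls_nth ((fls_deriv ^^ k) f) (int (Suc m))"
      by (simp only: funpow.simps o_apply fls_deriv_nth)
    also have "\<dots> = of_nat (Suc m * (\<Prod>j=1..k. Suc m + j)) * fls_nth f (int (m + Suc k))"
      by (simp only: Suc.IH of_int_of_nat_eq of_nat_mult mult.assoc add_Suc add_Suc_right)
    also have "Suc m * (\<Prod>j=1..k. Suc m + j) = (\<Prod>j=1..Suc k. m + j)"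
      by (simp add: prod.atLeast_Suc_atMost_Suc_shift prod.atLeast_Suc_atMost[of 0 k] del: prod.cl_ivl_Suc)
    finally show ?case .
  qed simp
  from this[of 0] show ?thesis by (simp add: fact_prod)
qed

lemma Lam_eq_sum: 
  "Lam c d p = (\<Sum>k\<le>degree p. smult (of_nat (fact k) * coeff p k) (mellin_poly c d (Suc k)))"
  unfolding Lam_def fls_nth_higher_deriv_0 fls_nth_mellin_product
  by (simp add: of_nat_poly mult.commute)

text \<open>The factor \<open>fact k\<close> produced by differentiating \<open>k\<close> times
  cancels the denominator of the divided power.\<close>

lemma Lam_divided_power: "Lam c d (divided_power k) = mellin_poly c d (Suc k)"
proof -
  have "degree (divided_power k) \<le> k" by (simp add: divided_power_def degree_monom_le)
  hence "Lam c d (divided_power k) = (\<Sum>j\<le>k. smult (of_nat (fact j) * coeff (divided_power k) j) (mellin_poly c d (Suc j)))"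
    unfolding Lam_altdef[OF \<open>degree (divided_power k) \<le> k\<close>] fls_nth_higher_deriv_0 fls_nth_mellin_product
    by (simp add: of_nat_poly mult.commute)
  also have "\<dots> = (\<Sum>j\<le>k. if j = k then mellin_poly c d (Suc j) else 0)"
    by (rule sum.cong) (auto simp: coeff_divided_power of_nat_mult_scaleQ scaleQ_one)
  finally show ?thesis by simp
qed

text \<open>Reduces identities that are linear in \<open>p\<close> to divided powers.\<close>

lemma divided_power_expansion:
  fixes p :: "'a::comm_rat_algebra_1 poly"
  shows "p = (\<Sum>k\<le>degree p. smult (of_nat (fact k) * coeff p k) (divided_power k))"
proof -
  have "smult (of_nat (fact k) * coeff p k) (divided_power k) = monom (coeff p k) k" for k
    by (rule poly_eqI)
      (simp add: coeff_divided_power mult.commute[of "coeff p k"] mult.left_commute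
        of_nat_mult_scaleQ mult.assoc mult_scaleQ_left scaleQ_one)
  thus ?thesis by (simp add: poly_as_sum_of_monoms)
qed

text \<open>Differentiation lowers the index of each divided power by one, and the summand
  \<open>i = 1\<close> becomes the constant.\<close>

lemma poly_deriv_mellin_poly_Suc: "poly_deriv (mellin_poly c d (Suc b)) = [:c b d:] + mellin_poly c d b"
proof -
  have "poly_deriv (mellin_poly c d (Suc b)) = (\<Sum>i=0..b. smult (c (b - i) d) (divided_power i))"
    unfolding mellin_poly_def poly_deriv_sum One_nat_def sum.atLeast_Suc_atMost_Suc_shift
    by (simp add: poly_deriv_smult poly_deriv_divided_power_Suc)
  also have "\<dots> = [:c b d:] + mellin_poly c d b"
    by (simp add: mellin_poly_def sum.atLeast_Suc_atMost[of 0 b] divided_power_0)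
  finally show ?thesis .
qed

text \<open>Both sides are linear in \<open>p\<close>, and on divided powers this is
  \<open>poly_deriv_mellin_poly_Suc\<close>. The coefficient at 1 is the value of the derivative at
  0.\<close>

lemma poly_deriv_Lam: "poly_deriv (Lam c d p) = [:coeff (Lam c d p) 1:] + Lam c d (poly_deriv p)"
proof -
  have dp: "poly_deriv (Lam c d (divided_power k)) =
    [:coeff (Lam c d (divided_power k)) 1:] + Lam c d (poly_deriv (divided_power k))" for k
    by (cases k)
      (simp_all add: Lam_divided_power poly_deriv_mellin_poly_Suc
        coeff_1_mellin_poly[unfolded One_nat_def] poly_deriv_divided_power_0
        poly_deriv_divided_power_Suc Lam_0 mellin_poly_def[of c d 0])
  have "poly_deriv (Lam c d (\<Sum>k\<in>I. smult (a k) (divided_power k))) =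
    [:coeff (Lam c d (\<Sum>k\<in>I. smult (a k) (divided_power k))) 1:] +
    Lam c d (poly_deriv (\<Sum>k\<in>I. smult (a k) (divided_power k)))" for I a
    by (induction I rule: infinite_finite_induct)
       (simp_all add: Lam_0 poly_deriv_0 Lam_add poly_deriv_add Lam_smult poly_deriv_smult dp smult_add_right add_ac)
  from this[of _ "{..degree p}"] show ?thesis
    by (metis divided_power_expansion[of p])
qed

lemma coeff_0_Lam: "coeff (Lam c d p) 0 = 0"
  by (simp add: Lam_eq_sum coeff_sum coeff_0_mellin_poly)


subsection \<open>Cutting a tree along an edge\<close>

text \<open>Each cut consists of the part containing the root and of the subtree below the deleted edge.\<close>

primrec cuts :: "'v rtree \<Rightarrow> ('v rtree \<times> 'v rtree) multiset" where
  "cuts (Node v ts) = \<Sum>\<^sub># (image_mset (\<lambda>s. add_mset (Node v (ts - {#s#}), s)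
     (image_mset (\<lambda>(a, b). (Node v (add_mset a (ts - {#s#})), b)) (cuts s))) ts)"

lemma image_mset_sum_mset: "image_mset f (\<Sum>s\<in>#M. g s) = (\<Sum>s\<in>#M. image_mset f (g s))"
  by (induction M) auto

text \<open>An edge is named by its lower end, and every vertex but the root is the lower end of one
  edge. Multiplicities are kept, so repeated names are counted correctly.\<close>

lemma image_root_cuts:
  "add_mset (root T) (image_mset (root \<circ> snd) (cuts T)) = verts_mset T"
proof (induction T)
  case (Node v ts)
  have "image_mset (root \<circ> snd) (cuts (Node v ts)) =
    (\<Sum>s\<in>#ts. add_mset (root s) (image_mset (root \<circ> snd) (cuts s)))"
    by (simp add: image_mset_sum_mset image_mset.compositionality comp_def case_prod_unfold)
  also have "\<dots> = (\<Sum>s\<in>#ts. verts_mset s)"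
    by (rule arg_cong[where f = sum_mset], rule image_mset_cong) (rule Node)
  finally show ?case by (simp only: verts_mset.simps rtree.sel)
qed

section \<open>Vertices and arcs of the two parts of a cut\<close>

lemma set_mset_verts_mset: "set_mset (verts_mset T) = verts T"
  by (induction T) auto

lemma finite_verts: "finite (verts T)"
  by (simp flip: set_mset_verts_mset)

lemma root_in_verts: "root T \<in> verts T"
  by (cases T) simp

text \<open>The multiplicities of a name in \<open>a\<close> and \<open>b\<close> add up to at most
  one. This serves both for cuts and for splitting one branch off the root.\<close>

lemma distinct_verts_if_add:
  assumes "distinct_verts T" "verts_mset a + verts_mset b = verts_mset T"
  shows "distinct_verts a" "distinct_verts b" "verts a \<inter> verts b = {}" "verts a \<union> verts b = verts T"
proof -
  have c: "count (verts_mset a) v + count (verts_mset b) v \<le> 1" for v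
    using assms(1) by (metis distinct_verts_def assms(2) count_union)
  show "distinct_verts a" "distinct_verts b"
    unfolding distinct_verts_def using c by (meson add_leD1 add_leD2)+
  show "verts a \<inter> verts b = {}"
  proof (rule ccontr)
    assume "verts a \<inter> verts b \<noteq> {}"
    then obtain v where "v \<in># verts_mset a" "v \<in># verts_mset b"
      by (auto simp: set_mset_verts_mset)
    thus False using c[of v] by (simp flip: count_greater_zero_iff)
  qed
  show "verts a \<union> verts b = verts T"
    using assms(2) by (metis set_mset_union set_mset_verts_mset)
qed

lemma cuts_cases:
  assumes "(a, b) \<in># cuts (Node v ts)"
  obtains (top) ts' where "ts = add_mset b ts'" "a = Node v ts'"
  | (sub) s ts' a' where "ts = add_mset s ts'" "(a', b) \<in># cuts s" "a = Node v (add_mset a' ts')"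
proof -
  from assms obtain s where s: "s \<in># ts" "(a, b) = (Node v (ts - {#s#}), s) \<or>
    (\<exists>a'. (a', b) \<in># cuts s \<and> a = Node v (add_mset a' (ts - {#s#})))"
    by auto
  have "ts = add_mset s (ts - {#s#})" using s by simp
  thus ?thesis using s(2) top sub by blast
qed

lemma arcs_add:
  "arcs (Node v (add_mset s ts)) = insert (v, root s) (arcs s \<union> arcs (Node v ts))"
  by auto

text \<open>Induction on the tree, with the deleted edge either at the root or inside a branch. The
  arc from \<open>p\<close> to \<open>root b\<close> is the deleted edge.\<close>

lemma cuts_parts:
  assumes "(a, b) \<in># cuts T"
  shows "verts_mset a + verts_mset b = verts_mset T" (is ?V)
    and "root a = root T" (is ?R)
    and "\<exists>p\<in>verts a. arcs T = insert (p, root b) (arcs a \<union> arcs b)" (is ?A)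
proof -
  from assms have "?V \<and> ?R \<and> ?A"
  proof (induction T arbitrary: a)
    case (Node v ts)
    from Node.prems show ?case
    proof (cases rule: cuts_cases)
      case (top ts')
      thus ?thesis by auto
    next
      case (sub s ts' a')
      have "s \<in># ts" using sub by simp
      from Node.IH[OF this sub(2)] obtain p where
        p: "verts_mset a' + verts_mset b = verts_mset s" "root a' = root s" "p \<in> verts a'"
        "arcs s = insert (p, root b) (arcs a' \<union> arcs b)" by blast
      have "verts_mset a + verts_mset b = verts_mset (Node v ts)"
        by (simp add: sub p(1)[symmetric])
      moreover have "arcs (Node v ts) = insert (p, root b) (arcs a \<union> arcs b)"
        unfolding sub(1,3) arcs_add p by auto
      moreover have "p \<in> verts a" using p(3) sub(3) by simp
      ultimately show ?thesis using sub(3) by auto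
    qed
  qed
  thus ?V ?R ?A by auto
qed

section \<open>Unique parents and the distance from the root\<close>

lemma arcs_subset: "arcs T \<subseteq> verts T \<times> verts T"
proof (induction T)
  case (Node v ts)
  have "arcs s \<subseteq> verts (Node v ts) \<times> verts (Node v ts)" if "s \<in># ts" for s
    using Node[OF that] that by auto
  thus ?case using root_in_verts by auto
qed

lemma distinct_verts_child:
  assumes "distinct_verts (Node v ts)" "s \<in># ts"
  shows "distinct_verts s" "v \<notin> verts s"
    "\<And>s' x. s' \<in># ts \<Longrightarrow> x \<in> verts s \<Longrightarrow> x \<in> verts s' \<Longrightarrow> s = s'"
proof -
  obtain ts' where ts: "ts = add_mset s ts'" using assms(2) by (metis mset_add)
  \<comment> \<open>The branch \<open>s\<close> and the rest of the tree are the two parts obtained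
    by deleting the edge above \<open>root s\<close>.\<close>
  have *: "verts_mset s + verts_mset (Node v ts') = verts_mset (Node v ts)"
    by (simp add: ts)
  note d = distinct_verts_if_add[OF assms(1) *]
  show "distinct_verts s" by (rule d)
  show "v \<notin> verts s" using d(3) by auto
  fix s' x assume "s' \<in># ts" "x \<in> verts s" "x \<in> verts s'"
  thus "s = s'" using d(3) unfolding ts by auto
qed

lemma root_no_parent:
  assumes "distinct_verts T"
  shows "(u, root T) \<notin> arcs T"
proof (cases T)
  case (Node v ts)
  have "v \<notin> verts s" if "s \<in># ts" for s
    using distinct_verts_child(2)[of v ts s] assms that Node by simp
  hence "v \<noteq> root s \<and> (u, v) \<notin> arcs s" if "s \<in># ts" for s
    using that root_in_verts[of s] arcs_subset[of s] by auto
  thus ?thesis by (auto simp: Node)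
qed

text \<open>Branches share no vertices. If \<open>x\<close> is the root of a branch, no arc inside a
  branch ends in \<open>x\<close>; otherwise both arcs lie in the same branch and induction
  applies.\<close>

lemma arcs_parent_unique:
  "distinct_verts T \<Longrightarrow> (u, x) \<in> arcs T \<Longrightarrow> (w, x) \<in> arcs T \<Longrightarrow> u = w"
proof (induction T)
  case (Node v ts)
  note d = distinct_verts_child[OF Node.prems(1)]
  have *: "(z, root s) \<notin> arcs s'" if "s \<in># ts" "s' \<in># ts" for z s s'
  proof
    assume z: "(z, root s) \<in> arcs s'"
    hence "root s \<in> verts s'" using arcs_subset by blast
    hence "s = s'" using d(3)[OF that] root_in_verts by auto
    thus False using z root_no_parent[OF d(1)[OF that(1)], of z] by simp
  qed
  have arcsE: "(z = v \<and> (\<exists>s\<in>#ts. x = root s)) \<or> (\<exists>s\<in>#ts. (z, x) \<in> arcs s)" if "(z, x) \<in> arcs (Node v ts)" for z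
    using that by auto
  show ?case
  proof (cases "\<exists>s\<in>#ts. x = root s")
    case True
    thus ?thesis using arcsE[OF Node.prems(2)] arcsE[OF Node.prems(3)] * by blast
  next
    case False
    then obtain s s' where s: "s \<in># ts" "s' \<in># ts" "(u, x) \<in> arcs s" "(w, x) \<in> arcs s'"
      using arcsE[OF Node.prems(2)] arcsE[OF Node.prems(3)] by blast
    hence "s = s'" using d(3)[OF s(1,2), of x] arcs_subset by blast
    thus ?thesis using Node.IH[OF s(1) d(1)[OF s(1)]] s by auto
  qed
qed

lemma root_reaches: "x \<in> verts T \<Longrightarrow> (root T, x) \<in> (arcs T)\<^sup>*"
proof (induction T)
  case (Node v ts)
  show ?case
  proof (cases "x = v")
    case False
    then obtain s where s: "s \<in># ts" "x \<in> verts s" using Node.prems by auto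
    have "(root s, x) \<in> (arcs s)\<^sup>*" using Node.IH s by blast
    moreover have "arcs s \<subseteq> arcs (Node v ts)" using s by auto
    ultimately have "(root s, x) \<in> (arcs (Node v ts))\<^sup>*" using rtrancl_mono by blast
    moreover have "(v, root s) \<in> arcs (Node v ts)" using s by auto
    ultimately show ?thesis by (simp add: converse_rtrancl_into_rtrancl)
  qed simp
qed

text \<open>Both paths are traced back from \<open>x\<close> through unique parents, and they stop
  only at the root, which has no parent.\<close>

lemma arcs_relpow_unique:
  assumes "distinct_verts T" "(root T, x) \<in> arcs T ^^ m" "(root T, x) \<in> arcs T ^^ n"
  shows "m = n"
  using assms(2,3)
proof (induction m arbitrary: n x)
  case 0
  thus ?case using root_no_parent[OF assms(1)] by (cases n) auto
next
  case (Suc m)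
  then obtain y where y: "(root T, y) \<in> arcs T ^^ m" "(y, x) \<in> arcs T" by auto
  show ?case
  proof (cases n)
    case 0
    thus ?thesis using Suc.prems y root_no_parent[OF assms(1)] by auto
  next
    case (Suc n')
    then obtain z where z: "(root T, z) \<in> arcs T ^^ n'" "(z, x) \<in> arcs T" using Suc.prems by auto
    thus ?thesis using Suc.IH[OF y(1)] arcs_parent_unique[OF assms(1) y(2) z(2)] Suc by auto
  qed
qed

text \<open>The distance is defined by undirected walks, but no such walk is shorter than the
  directed path from the root.\<close>

lemma root_dist_eq:
  assumes "distinct_verts T" "(root T, x) \<in> arcs T ^^ n"
  shows "root_dist T x = n"
  unfolding root_dist_def
proof (rule Least_equality)
  show "(root T, x) \<in> adj T ^^ n" using assms(2)
    by (induction n arbitrary: x) (auto simp: adj_def)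
next
  fix m assume "(root T, x) \<in> adj T ^^ m"
  hence "\<exists>k\<le>m. (root T, x) \<in> arcs T ^^ k"
  proof (induction m arbitrary: x)
    case (Suc m)
    then obtain y where y: "(root T, y) \<in> adj T ^^ m" "(y, x) \<in> adj T" by auto
    from Suc.IH[OF y(1)] obtain k where k: "k \<le> m" "(root T, y) \<in> arcs T ^^ k" by blast
    from y(2) consider "(y, x) \<in> arcs T" | "(x, y) \<in> arcs T" by (auto simp: adj_def)
    thus ?case
    proof cases
      case 1
      hence "(root T, x) \<in> arcs T ^^ Suc k" using k by auto
      thus ?thesis using k(1) by (meson Suc_le_mono)
    next
      case 2
      \<comment> \<open>A step against an arc leads back to the unique parent, so it undoes the last
        step of the directed path.\<close>
      hence "k \<noteq> 0" using k(2) root_no_parent[OF assms(1)] by (metis relpow_0_E)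
      then obtain j where j: "k = Suc j" by (cases k) auto
      then obtain z where z: "(root T, z) \<in> arcs T ^^ j" "(z, y) \<in> arcs T" using k(2) by auto
      hence "z = x" using arcs_parent_unique[OF assms(1) z(2) 2] by simp
      thus ?thesis using z k(1) j by (intro exI[of _ j]) auto
    qed
  qed auto
  thus "n \<le> m" using arcs_relpow_unique[OF assms(1) assms(2)] by blast
qed

lemma root_dist_arc:
  assumes "distinct_verts T" "(x, y) \<in> arcs T"
  shows "root_dist T y = Suc (root_dist T x)"
proof -
  have "x \<in> verts T" using assms(2) arcs_subset by blast
  hence "(root T, x) \<in> (arcs T)\<^sup>*" by (rule root_reaches)
  then obtain n where n: "(root T, x) \<in> arcs T ^^ n" unfolding rtrancl_power ..
  hence "(root T, y) \<in> arcs T ^^ Suc n" using assms(2) by auto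
  thus ?thesis using n assms(1) by (simp add: root_dist_eq del: relpow.simps)
qed

lemma root_dist_descendant:
  assumes "distinct_verts T" "(x, y) \<in> (arcs T)\<^sup>*"
  shows "x = y \<or> root_dist T x < root_dist T y"
  using assms(2)
proof (induction rule: rtrancl_induct)
  case (step y z)
  thus ?case using root_dist_arc[OF assms(1) step.hyps(2)] by auto
qed simp

section \<open>Tubes as sets with a topmost vertex\<close>

text \<open>A directed form of connectedness: all of \<open>X\<close> is reached from
  \<open>v\<close> by downward paths inside \<open>X\<close>. It allows inductions along parents and
  passes easily to the parts of a cut.\<close>

definition rooted_at :: "'v rtree \<Rightarrow> 'v \<Rightarrow> 'v set \<Rightarrow> bool" where
  "rooted_at T v X \<longleftrightarrow> v \<in> X \<and> X \<subseteq> verts T \<and> (\<forall>u\<in>X. (v, u) \<in> (Restr (arcs T) X)\<^sup>*)"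

lemma rooted_at_imp_tube:
  assumes "rooted_at T v X"
  shows "tube T X"
proof -
  have "Restr (arcs T) X \<subseteq> Restr (adj T) X" by (auto simp: adj_def)
  hence *: "(v, u) \<in> (Restr (adj T) X)\<^sup>*" if "u \<in> X" for u
    using assms that rtrancl_mono unfolding rooted_at_def by blast
  have "sym (Restr (adj T) X)" by (auto simp: adj_def sym_def)
  hence "(u, v) \<in> (Restr (adj T) X)\<^sup>*" if "u \<in> X" for u
    using *[OF that] by (meson sym_rtrancl symD)
  thus ?thesis using assms * unfolding tube_def rooted_at_def
    by (metis empty_iff rtrancl_trans)
qed

text \<open>An undirected walk that starts at the vertex nearest to the root can be made downward: a
  step up from \<open>y\<close> goes to its parent, which already precedes \<open>y\<close> on the
  downward path.\<close>

lemma tube_imp_rooted_at: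
  assumes "distinct_verts T" "tube T X"
  shows "\<exists>v. rooted_at T v X"
proof -
  have X: "X \<noteq> {}" "X \<subseteq> verts T" "\<And>u v. u \<in> X \<Longrightarrow> v \<in> X \<Longrightarrow> (u, v) \<in> (Restr (adj T) X)\<^sup>*"
    using assms(2) by (auto simp: tube_def)
  obtain v where v: "v \<in> X" "\<And>u. u \<in> X \<Longrightarrow> root_dist T v \<le> root_dist T u"
    using X(1) ex_has_least_nat[of "\<lambda>u. u \<in> X" _ "root_dist T"] by blast
  have "(v, u) \<in> (Restr (arcs T) X)\<^sup>*" if "u \<in> X" for u
    using X(3)[OF v(1) that]
  proof (induction rule: rtrancl_induct)
    case (step y z)
    from step.hyps(2) have yz: "y \<in> X" "z \<in> X" "(y, z) \<in> arcs T \<or> (z, y) \<in> arcs T"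
      by (auto simp: adj_def)
    show ?case
    proof (cases "(y, z) \<in> arcs T")
      case True
      thus ?thesis using step.IH yz by (meson IntI SigmaI rtrancl.rtrancl_into_rtrancl)
    next
      case False
      hence zy: "(z, y) \<in> arcs T" using yz by blast
      \<comment> \<open>Otherwise \<open>z\<close> would be a vertex of \<open>X\<close> nearer to
        the root than \<open>v\<close>.\<close>
      hence "y \<noteq> v" using root_dist_arc[OF assms(1)] v(2)[OF yz(2)] by fastforce
      then obtain w where w: "(v, w) \<in> (Restr (arcs T) X)\<^sup>*" "(w, y) \<in> Restr (arcs T) X"
        using step.IH by (metis rtranclE)
      thus ?thesis using arcs_parent_unique[OF assms(1) zy, of w] by auto
    qed
  qed simp
  thus ?thesis using v(1) X(2) by (auto simp: rooted_at_def)
qed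

lemma rooted_at_descendant: "rooted_at T v X \<Longrightarrow> u \<in> X \<Longrightarrow> (v, u) \<in> (arcs T)\<^sup>*"
  unfolding rooted_at_def by (meson inf_le1 rtrancl_mono subsetD)

text \<open>All other vertices of \<open>X\<close> are proper descendants of \<open>v\<close> and
  hence farther from the root, so the choice made by \<open>arg_min_on\<close> is forced.\<close>

lemma tube_root_eq:
  assumes "distinct_verts T" "rooted_at T v X"
  shows "tube_root T X = v"
proof -
  have X: "finite X" "X \<noteq> {}" "v \<in> X"
    using assms(2) finite_subset[OF _ finite_verts] unfolding rooted_at_def by auto
  hence "arg_min_on (root_dist T) X \<in> X" "root_dist T (arg_min_on (root_dist T) X) \<le> root_dist T v"
    by (auto intro: arg_min_if_finite arg_min_least)
  thus ?thesis
    using root_dist_descendant[OF assms(1) rooted_at_descendant[OF assms(2)]]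
    unfolding tube_root_def by fastforce
qed

lemma tube_iff_rooted_at: "distinct_verts T \<Longrightarrow> tube T X \<longleftrightarrow> (\<exists>v. rooted_at T v X)"
  by (auto intro: rooted_at_imp_tube tube_imp_rooted_at)

lemma rooted_at_verts: "rooted_at T (root T) (verts T)"
proof -
  have "Restr (arcs T) (verts T) = arcs T" using arcs_subset by blast
  thus ?thesis by (simp add: rooted_at_def root_in_verts root_reaches)
qed

lemma tube_root_in: "distinct_verts T \<Longrightarrow> tube T X \<Longrightarrow> tube_root T X \<in> X"
  by (metis rooted_at_def tube_imp_rooted_at tube_root_eq)

section \<open>Partitions into two tubes and their cuts\<close>

text \<open>The point is that the right-hand side depends on \<open>v\<close> only: a partition of
  the tree into two tubes is determined by the top of the part without the root.\<close>

lemma split_lower_part: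
  assumes T: "distinct_verts T" and YZ: "tube T Y" "rooted_at T v Z"
    "Y \<union> Z = verts T" "Y \<inter> Z = {}" "root T \<in> Y"
  shows "Z = {u \<in> verts T. (v, u) \<in> (arcs T)\<^sup>*}"
proof (intro equalityI subsetI CollectI conjI)
  fix u assume "u \<in> Z"
  thus "u \<in> verts T" "(v, u) \<in> (arcs T)\<^sup>*"
    using YZ rooted_at_descendant by auto
next
  fix u assume u: "u \<in> {u \<in> verts T. (v, u) \<in> (arcs T)\<^sup>*}"
  show "u \<in> Z"
  proof (rule ccontr)
    assume "u \<notin> Z"
    hence "u \<in> Y" using u YZ(3) by auto
    have v: "v \<notin> Y" using YZ by (auto simp: rooted_at_def)
    from YZ(1) T obtain r where r: "rooted_at T r Y" using tube_iff_rooted_at by blast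
    have "r = root T"
      using rooted_at_descendant[OF r YZ(5)] root_no_parent[OF T] by (blast elim: rtranclE)
    hence "(root T, u) \<in> (Restr (arcs T) Y)\<^sup>*"
      using r \<open>u \<in> Y\<close> by (simp add: rooted_at_def)
    \<comment> \<open>Along the path from the root inside \<open>Y\<close>, no vertex lies below
      \<open>v\<close>: an ancestor path from \<open>v\<close> would have to pass through the
      preceding vertex as well.\<close>
    hence "(v, u) \<notin> (arcs T)\<^sup>*"
    proof (induction rule: rtrancl_induct)
      case base
      show ?case using root_no_parent[OF T] YZ(5) v by (blast elim: rtranclE)
    next
      case (step y z)
      show ?case
      proof
        assume "(v, z) \<in> (arcs T)\<^sup>*"
        moreover have "v \<noteq> z" using step.hyps v by auto
        ultimately obtain w where w: "(v, w) \<in> (arcs T)\<^sup>*" "(w, z) \<in> arcs T" by (metis rtranclE)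
        have "w = y" using arcs_parent_unique[OF T w(2)] step.hyps by blast
        thus False using w step.IH by simp
      qed
    qed
    thus False using u by simp
  qed
qed

lemma cut_with_root:
  assumes "v \<in> verts T" "v \<noteq> root T"
  shows "\<exists>a b. (a, b) \<in># cuts T \<and> root b = v"
proof -
  have "v \<in># add_mset (root T) (image_mset (root \<circ> snd) (cuts T))"
    using assms by (simp only: image_root_cuts set_mset_verts_mset)
  thus ?thesis using assms(2) by fastforce
qed

text \<open>If the images have no repetition, neither has \<open>M\<close>, so a sum over the
  multiset is a sum over its underlying set.\<close>

lemma count_le_1_imageD:
  assumes "\<And>y. count (image_mset f M) y \<le> 1"
  shows "inj_on f (set_mset M)" "(\<Sum>x\<in>#M. g x) = (\<Sum>x\<in>set_mset M. g x)"
proof -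
  have "inj_on f (set_mset M) \<and> (\<Sum>x\<in>#M. g x) = (\<Sum>x\<in>set_mset M. g x)"
    using assms
  proof (induction M)
    case (add x M)
    have "count (image_mset f M) y \<le> 1" for y
      using add.prems[of y] by (auto split: if_splits)
    moreover have "count (image_mset f M) (f x) = 0" using add.prems[of "f x"] by simp
    hence "f x \<notin># image_mset f M" by (simp only: not_in_iff)
    hence "f x \<notin> f ` set_mset M" by simp
    moreover from this have "x \<notin># M" by blast
    ultimately show ?case using add.IH by (auto simp: inj_on_insert)
  qed auto
  thus "inj_on f (set_mset M)" "(\<Sum>x\<in>#M. g x) = (\<Sum>x\<in>set_mset M. g x)" by auto
qed

text \<open>By \<open>image_root_cuts\<close> the lower parts have pairwise different roots, so the
  root of the lower part identifies the cut.\<close>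

lemma cuts_distinct:
  assumes "distinct_verts T"
  shows "inj_on (root \<circ> snd) (set_mset (cuts T))"
    and "(\<Sum>x\<in>#cuts T. g x) = (\<Sum>x\<in>set_mset (cuts T). g x)"
proof -
  have "count (image_mset (root \<circ> snd) (cuts T)) v \<le> 1" for v
  proof -
    have "count (add_mset (root T) (image_mset (root \<circ> snd) (cuts T))) v \<le> 1"
      using assms unfolding image_root_cuts distinct_verts_def by blast
    thus ?thesis by (auto split: if_splits)
  qed
  thus "inj_on (root \<circ> snd) (set_mset (cuts T))" "(\<Sum>x\<in>#cuts T. g x) = (\<Sum>x\<in>set_mset (cuts T). g x)"
    by (rule count_le_1_imageD)+
qed

section \<open>Tubes and tubings of the two parts of a fixed cut\<close>

locale tree_cut =
  fixes T a b :: "'v rtree"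
  assumes distinct: "distinct_verts T" and cut: "(a, b) \<in># cuts T"
begin

lemma distinct_parts: "distinct_verts a" "distinct_verts b"
  and verts_disjoint: "verts a \<inter> verts b = {}" and verts_union: "verts a \<union> verts b = verts T"
  using distinct_verts_if_add[OF distinct cuts_parts(1)[OF cut]] by auto

lemma root_upper: "root a = root T"
  by (rule cuts_parts(2)[OF cut])

text \<open>The deleted arc has one end in each part, so it disappears when arcs are restricted to a
  subset of either part.\<close>

lemma Restr_arcs:
  shows "X \<subseteq> verts a \<Longrightarrow> Restr (arcs a) X = Restr (arcs T) X"
    and "X \<subseteq> verts b \<Longrightarrow> Restr (arcs b) X = Restr (arcs T) X"
proof -
  obtain p where p: "p \<in> verts a" "arcs T = insert (p, root b) (arcs a \<union> arcs b)"
    using cuts_parts(3)[OF cut] by blast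
  have *: "root b \<in> verts b" by (rule root_in_verts)
  show "X \<subseteq> verts a \<Longrightarrow> Restr (arcs a) X = Restr (arcs T) X"
    using p * verts_disjoint arcs_subset[of b] by auto
  show "X \<subseteq> verts b \<Longrightarrow> Restr (arcs b) X = Restr (arcs T) X"
    using p * verts_disjoint arcs_subset[of a] by auto
qed

lemma rooted_at_parts:
  shows "rooted_at a v X \<longleftrightarrow> rooted_at T v X \<and> X \<subseteq> verts a"
    and "rooted_at b v X \<longleftrightarrow> rooted_at T v X \<and> X \<subseteq> verts b"
proof -
  have sub: "verts a \<subseteq> verts T" "verts b \<subseteq> verts T" using verts_union by auto
  show "rooted_at a v X \<longleftrightarrow> rooted_at T v X \<and> X \<subseteq> verts a"
    by (cases "X \<subseteq> verts a") (use Restr_arcs(1)[of X] sub in \<open>auto simp: rooted_at_def\<close>)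
  show "rooted_at b v X \<longleftrightarrow> rooted_at T v X \<and> X \<subseteq> verts b"
    by (cases "X \<subseteq> verts b") (use Restr_arcs(2)[of X] sub in \<open>auto simp: rooted_at_def\<close>)
qed

lemma tube_parts:
  shows "tube a X \<longleftrightarrow> tube T X \<and> X \<subseteq> verts a"
    and "tube b X \<longleftrightarrow> tube T X \<and> X \<subseteq> verts b"
  by (auto simp: tube_iff_rooted_at distinct distinct_parts rooted_at_parts)

lemma tube_root_parts:
  shows "tube a X \<Longrightarrow> tube_root a X = tube_root T X"
    and "tube b X \<Longrightarrow> tube_root b X = tube_root T X"
  by (auto simp: tube_iff_rooted_at distinct_parts rooted_at_parts tube_root_eq distinct)

text \<open>Tubes of the parts keep their roots. The only new tube is \<open>verts T\<close>, which
  is rooted at \<open>root T\<close> and raises the count there by one.\<close>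

lemma tube_count_join:
  assumes "\<forall>X\<in>\<tau>. tube a X" "\<forall>X\<in>\<tau>'. tube b X"
  shows "v \<in> verts a \<Longrightarrow> v \<noteq> root T \<Longrightarrow> tube_count T v (insert (verts T) (\<tau> \<union> \<tau>')) = tube_count a v \<tau>"
    and "tube_count T (root T) (insert (verts T) (\<tau> \<union> \<tau>')) = Suc (tube_count a (root T) \<tau>)"
    and "v \<in> verts b \<Longrightarrow> tube_count T v (insert (verts T) (\<tau> \<union> \<tau>')) = tube_count b v \<tau>'"
proof -
  have rT: "tube_root T (verts T) = root T" by (rule tube_root_eq[OF distinct rooted_at_verts])
  have a: "tube_root a X = tube_root T X" "tube_root T X \<in> verts a" "X \<subseteq> verts a" if "X \<in> \<tau>" for X
    using assms(1) that tube_root_parts(1) tube_root_in[OF distinct_parts(1)] by (auto simp: tube_parts) (metis subsetD)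
  have b: "tube_root b X = tube_root T X" "tube_root T X \<in> verts b" if "X \<in> \<tau>'" for X
    using assms(2) that tube_root_parts(2) tube_root_in[OF distinct_parts(2)] by (auto simp: tube_parts) (metis subsetD)
  have ra: "root T \<in> verts a" using root_in_verts[of a] by (simp add: root_upper)
  show "tube_count T v (insert (verts T) (\<tau> \<union> \<tau>')) = tube_count a v \<tau>"
    if "v \<in> verts a" "v \<noteq> root T"
  proof -
    have "tube_root T X \<noteq> v" if "X \<in> insert (verts T) \<tau>'" for X
      using b(2)[of X] that rT \<open>v \<in> verts a\<close> \<open>v \<noteq> root T\<close> verts_disjoint by auto
    hence "{X \<in> insert (verts T) (\<tau> \<union> \<tau>'). tube_root T X = v} = {X \<in> \<tau>. tube_root a X = v}"
      using a(1) by auto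
    thus ?thesis by (simp only: tube_count_def)
  qed
  show "tube_count T v (insert (verts T) (\<tau> \<union> \<tau>')) = tube_count b v \<tau>'" if "v \<in> verts b"
  proof -
    have "tube_root T X \<noteq> v" if "X \<in> insert (verts T) \<tau>" for X
      using a(2)[of X] that rT ra \<open>v \<in> verts b\<close> verts_disjoint by auto
    hence "{X \<in> insert (verts T) (\<tau> \<union> \<tau>'). tube_root T X = v} = {X \<in> \<tau>'. tube_root b X = v}"
      using b(1) by auto
    thus ?thesis by (simp only: tube_count_def)
  qed
  have "tube_root T X \<noteq> root T" if "X \<in> \<tau>'" for X
    using b(2)[OF that] ra verts_disjoint by auto
  hence eq: "{X \<in> insert (verts T) (\<tau> \<union> \<tau>'). tube_root T X = root T} =
     insert (verts T) {X \<in> \<tau>. tube_root a X = root T}"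
    using a(1) rT by auto
  \<comment> \<open>The added tube must be new for the cardinality to rise; it is, since
    \<open>b\<close> has at least one vertex.\<close>
  have "verts T \<notin> \<tau>" using a(3) verts_disjoint verts_union root_in_verts[of b] by auto
  moreover have "finite \<tau>" by (rule finite_subset[of _ "Pow (verts a)"]) (use a(3) finite_verts in auto)
  ultimately show "tube_count T (root T) (insert (verts T) (\<tau> \<union> \<tau>')) = Suc (tube_count a (root T) \<tau>)"
    unfolding tube_count_def eq by simp
qed

text \<open>The upper part shares its root with \<open>T\<close>, but \<open>root b\<close> is an
  ordinary vertex of \<open>T\<close>. Its factor is missing from the monomial of \<open>b\<close>
  and has to be supplied.\<close>

lemma mellin_monomial_join:
  assumes "\<forall>X\<in>\<tau>. tube a X" "\<forall>X\<in>\<tau>'. tube b X"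
  shows "mellin_monomial c T dec (insert (verts T) (\<tau> \<union> \<tau>')) =
    mellin_monomial c a dec \<tau> *
     (mellin_monomial c b dec \<tau>' * c (tube_count b (root b) \<tau>' - 1) (dec (root b)))"
proof -
  let ?f = "\<lambda>v. c (tube_count T v (insert (verts T) (\<tau> \<union> \<tau>')) - 1) (dec v)"
  have ra: "root T \<in> verts a" using root_in_verts[of a] by (simp add: root_upper)
  have "verts T - {root T} = (verts a - {root a}) \<union> verts b"
    using verts_union verts_disjoint ra root_upper by auto
  hence "mellin_monomial c T dec (insert (verts T) (\<tau> \<union> \<tau>')) = prod ?f (verts a - {root a}) * prod ?f (verts b)"
    unfolding mellin_monomial_def using verts_disjoint
    by (simp only:) (rule prod.union_disjoint, auto simp: finite_verts)
  also have "prod ?f (verts a - {root a}) = mellin_monomial c a dec \<tau>"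
    unfolding mellin_monomial_def using tube_count_join(1)[OF assms]
    by (intro prod.cong) (auto simp: root_upper)
  also have "prod ?f (verts b) = (\<Prod>v\<in>verts b. c (tube_count b v \<tau>' - 1) (dec v))"
    using tube_count_join(3)[OF assms] by (intro prod.cong) auto
  also have "\<dots> = mellin_monomial c b dec \<tau>' * c (tube_count b (root b) \<tau>' - 1) (dec (root b))"
    unfolding mellin_monomial_def
    by (subst prod.remove[OF finite_verts root_in_verts]) (simp add: mult.commute)
  finally show ?thesis .
qed

text \<open>The new tube \<open>verts T\<close> is partitioned by \<open>verts a\<close> and
  \<open>verts b\<close>, and tubes from different parts are disjoint.\<close>

lemma binary_tubing_join:
  assumes "\<tau> \<in> Tub a" "\<tau>' \<in> Tub b"
  shows "insert (verts T) (\<tau> \<union> \<tau>') \<in> Tub T"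
proof -
  have 1: "\<forall>X\<in>\<tau>. tube T X \<and> X \<subseteq> verts a" "\<forall>X\<in>\<tau>'. tube T X \<and> X \<subseteq> verts b"
    "verts a \<in> \<tau>" "verts b \<in> \<tau>'"
    using assms by (auto simp: Tub_def binary_tubing_def tube_parts)
  have lam: "\<forall>X\<in>\<tau>. \<forall>Y\<in>\<tau>. X \<subseteq> Y \<or> Y \<subseteq> X \<or> X \<inter> Y = {}" "\<forall>X\<in>\<tau>'. \<forall>Y\<in>\<tau>'. X \<subseteq> Y \<or> Y \<subseteq> X \<or> X \<inter> Y = {}"
    using assms by (auto simp: Tub_def binary_tubing_def)
  have split: "\<forall>X\<in>\<tau>. is_singleton X \<or> (\<exists>Y\<in>\<tau>. \<exists>Z\<in>\<tau>. Y \<union> Z = X \<and> Y \<inter> Z = {})"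
     "\<forall>X\<in>\<tau>'. is_singleton X \<or> (\<exists>Y\<in>\<tau>'. \<exists>Z\<in>\<tau>'. Y \<union> Z = X \<and> Y \<inter> Z = {})"
    using assms by (auto simp: Tub_def binary_tubing_def)
  let ?\<sigma> = "insert (verts T) (\<tau> \<union> \<tau>')"
  have "tube T (verts T)" by (rule rooted_at_imp_tube[OF rooted_at_verts])
  hence "\<forall>X\<in>?\<sigma>. tube T X" using 1 by blast
  moreover have "X \<subseteq> Y \<or> Y \<subseteq> X \<or> X \<inter> Y = {}" if X: "X \<in> ?\<sigma>" and Y: "Y \<in> ?\<sigma>" for X Y
  proof -
    have "verts a \<subseteq> verts T" "verts b \<subseteq> verts T" using verts_union by auto
    hence sub: "X \<subseteq> verts T" "Y \<subseteq> verts T" using X Y 1(1,2) by (blast intro: subset_trans)+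
    consider "X = verts T \<or> Y = verts T" | "X \<in> \<tau>" "Y \<in> \<tau>" | "X \<in> \<tau>'" "Y \<in> \<tau>'"
      | "X \<in> \<tau>" "Y \<in> \<tau>'" | "X \<in> \<tau>'" "Y \<in> \<tau>" using X Y by blast
    thus ?thesis
    proof cases
      case 1 thus ?thesis using sub by blast
    next
      case 2 thus ?thesis using lam by blast
    next
      case 3 thus ?thesis using lam by blast
    next
      case 4
      hence "X \<subseteq> verts a" "Y \<subseteq> verts b" using 1 by auto
      thus ?thesis using verts_disjoint by blast
    next
      case 5
      hence "X \<subseteq> verts b" "Y \<subseteq> verts a" using 1 by auto
      thus ?thesis using verts_disjoint by blast
    qed
  qed
  moreover have "is_singleton X \<or> (\<exists>Y\<in>?\<sigma>. \<exists>Z\<in>?\<sigma>. Y \<union> Z = X \<and> Y \<inter> Z = {})" if "X \<in> ?\<sigma>" for X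
  proof -
    consider "X = verts T" | "X \<in> \<tau>" | "X \<in> \<tau>'" using \<open>X \<in> ?\<sigma>\<close> by blast
    thus ?thesis
    proof cases
      case 1
      have "verts a \<in> ?\<sigma>" "verts b \<in> ?\<sigma>" using \<open>verts a \<in> \<tau>\<close> \<open>verts b \<in> \<tau>'\<close> by auto
      thus ?thesis using 1 verts_union verts_disjoint by blast
    next
      case 2
      thus ?thesis using split(1) by (meson UnI1 insertI2)
    next
      case 3
      thus ?thesis using split(2) by (meson UnI2 insertI2)
    qed
  qed
  ultimately show ?thesis unfolding Tub_def binary_tubing_def by (intro CollectI conjI ballI) auto
qed

text \<open>Tubes are nonempty and the parts are disjoint, so a tube of one part is not contained in
  the other.\<close>

lemma join_recover:
  assumes "\<tau> \<in> Tub a" "\<tau>' \<in> Tub b"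
  shows "\<tau> = {X \<in> insert (verts T) (\<tau> \<union> \<tau>'). X \<subseteq> verts a}"
    and "\<tau>' = {X \<in> insert (verts T) (\<tau> \<union> \<tau>'). X \<subseteq> verts b}"
proof -
  have 1: "\<forall>X\<in>\<tau>. X \<noteq> {} \<and> X \<subseteq> verts a" "\<forall>X\<in>\<tau>'. X \<noteq> {} \<and> X \<subseteq> verts b"
    using assms by (auto simp: Tub_def binary_tubing_def tube_def)
  have 2: "\<not> verts T \<subseteq> verts a" "\<not> verts T \<subseteq> verts b"
    using verts_union verts_disjoint root_in_verts[of a] root_in_verts[of b] by auto
  have 3: "\<not> X \<subseteq> verts b" if "X \<in> \<tau>" for X using that 1(1) verts_disjoint by (meson disjoint_iff ex_in_conv subsetD)
  have 4: "\<not> X \<subseteq> verts a" if "X \<in> \<tau>'" for X using that 1(2) verts_disjoint by (meson disjoint_iff ex_in_conv subsetD)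
  show "\<tau> = {X \<in> insert (verts T) (\<tau> \<union> \<tau>'). X \<subseteq> verts a}"
    using 1(1) 2(1) 4 by auto
  show "\<tau>' = {X \<in> insert (verts T) (\<tau> \<union> \<tau>'). X \<subseteq> verts b}"
    using 1(2) 2(2) 3 by auto
qed

end

section \<open>Each tubing of a tree with an edge comes from exactly one cut\<close>

text \<open>The partition of \<open>verts T\<close> within the tubing yields the cut: the top
  \<open>v\<close> of the tube without the root is the lower end of the deleted edge.\<close>

lemma Tub_split:
  assumes T: "distinct_verts T" "verts T \<noteq> {root T}" and \<sigma>: "\<sigma> \<in> Tub T"
  shows "\<exists>a b. (a, b) \<in># cuts T \<and> (\<exists>\<tau>\<in>Tub a. \<exists>\<tau>'\<in>Tub b. \<sigma> = insert (verts T) (\<tau> \<union> \<tau>'))"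
proof -
  have tubes: "\<forall>X\<in>\<sigma>. tube T X" and V: "verts T \<in> \<sigma>"
    and lam: "\<forall>X\<in>\<sigma>. \<forall>Y\<in>\<sigma>. X \<subseteq> Y \<or> Y \<subseteq> X \<or> X \<inter> Y = {}"
    and split: "\<forall>X\<in>\<sigma>. is_singleton X \<or> (\<exists>Y\<in>\<sigma>. \<exists>Z\<in>\<sigma>. Y \<union> Z = X \<and> Y \<inter> Z = {})"
    using \<sigma> by (auto simp: Tub_def binary_tubing_def)
  have "\<not> is_singleton (verts T)" using T(2) root_in_verts[of T] by (auto simp: is_singleton_def)
  then obtain Y Z where YZ: "Y \<in> \<sigma>" "Z \<in> \<sigma>" "Y \<union> Z = verts T" "Y \<inter> Z = {}" "root T \<in> Y"
    using split V root_in_verts[of T] by (metis Un_iff inf_commute sup_commute)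
  have tY: "tube T Y" and tZ: "tube T Z" using YZ tubes by auto
  from tZ T(1) obtain v where v: "rooted_at T v Z" using tube_iff_rooted_at by blast
  hence "v \<in> verts T" "v \<noteq> root T" using YZ by (auto simp: rooted_at_def)
  then obtain a b where ab: "(a, b) \<in># cuts T" "root b = v" using cut_with_root[of v T] by blast
  interpret tree_cut T a b using T ab by unfold_locales
  have "rooted_at T v (verts b)"
    using rooted_at_verts[of b] ab(2) rooted_at_parts(2) by simp
  moreover have "tube T (verts a)"
    using rooted_at_imp_tube[OF rooted_at_verts[of a]] tube_parts(1) by simp
  moreover have "root T \<in> verts a" using root_in_verts[of a] root_upper by simp
  \<comment> \<open>Both partitions have a lower part with top \<open>v\<close>, so
    \<open>split_lower_part\<close> describes both by the same set.\<close>
  ultimately have Z: "Z = verts b"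
    using split_lower_part[OF T(1) tY v YZ(3-5)] split_lower_part[OF T(1) _ _ verts_union verts_disjoint, of v]
    by blast
  hence Y: "Y = verts a" using YZ verts_union verts_disjoint by blast
  have ne: "X \<noteq> {}" "X \<subseteq> verts T" if "X \<in> \<sigma>" for X using tubes that by (auto simp: tube_def)
  define \<tau> where "\<tau> = {X \<in> \<sigma>. X \<subseteq> Y}"
  define \<tau>' where "\<tau>' = {X \<in> \<sigma>. X \<subseteq> Z}"
  \<comment> \<open>A tube inside neither \<open>Y\<close> nor \<open>Z\<close> meets both, hence
    contains both because tubes are nested or disjoint.\<close>
  have "X = verts T \<or> X \<subseteq> Y \<or> X \<subseteq> Z" if "X \<in> \<sigma>" for X
  proof -
    have "X \<subseteq> Y \<or> Y \<subseteq> X \<or> X \<inter> Y = {}" "X \<subseteq> Z \<or> Z \<subseteq> X \<or> X \<inter> Z = {}"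
      using lam that YZ by auto
    thus ?thesis using YZ(3) ne[OF that] ne(1)[OF YZ(1)] by blast
  qed
  hence "\<sigma> = insert (verts T) (\<tau> \<union> \<tau>')" using V by (auto simp: \<tau>_def \<tau>'_def)
  moreover have "\<tau> \<in> Tub a"
    unfolding Tub_def binary_tubing_def
  proof (intro CollectI conjI ballI)
    fix X assume "X \<in> \<tau>"
    hence X: "X \<in> \<sigma>" "X \<subseteq> Y" by (auto simp: \<tau>_def)
    show "tube a X" using X tubes by (simp add: tube_parts Y)
    show "is_singleton X \<or> (\<exists>A\<in>\<tau>. \<exists>B\<in>\<tau>. A \<union> B = X \<and> A \<inter> B = {})"
    proof (cases "is_singleton X")
      case False
      then obtain A B where "A \<in> \<sigma>" "B \<in> \<sigma>" "A \<union> B = X" "A \<inter> B = {}" using split X(1) by blast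
      thus ?thesis using X(2) unfolding \<tau>_def by blast
    qed simp
  qed (use YZ(1) lam in \<open>auto simp: \<tau>_def Y\<close>)
  moreover have "\<tau>' \<in> Tub b"
    unfolding Tub_def binary_tubing_def
  proof (intro CollectI conjI ballI)
    fix X assume "X \<in> \<tau>'"
    hence X: "X \<in> \<sigma>" "X \<subseteq> Z" by (auto simp: \<tau>'_def)
    show "tube b X" using X tubes by (simp add: tube_parts Z)
    show "is_singleton X \<or> (\<exists>A\<in>\<tau>'. \<exists>B\<in>\<tau>'. A \<union> B = X \<and> A \<inter> B = {})"
    proof (cases "is_singleton X")
      case False
      then obtain A B where "A \<in> \<sigma>" "B \<in> \<sigma>" "A \<union> B = X" "A \<inter> B = {}" using split X(1) by blast
      thus ?thesis using X(2) unfolding \<tau>'_def by blast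
    qed simp
  qed (use YZ(2) lam in \<open>auto simp: \<tau>'_def Z\<close>)
  ultimately show ?thesis using ab(1) by blast
qed

text \<open>The tube \<open>verts a\<close> contains the root, so in the other decomposition it must
  lie in the upper part. By symmetry the upper vertex sets agree, and this fixes the cut and then
  the tubings.\<close>

lemma join_cut_unique:
  assumes T: "distinct_verts T" and ab: "(a, b) \<in># cuts T" "(a', b') \<in># cuts T"
    and \<tau>: "\<tau> \<in> Tub a" "\<tau>1 \<in> Tub b" "\<tau>' \<in> Tub a'" "\<tau>1' \<in> Tub b'"
    and eq: "insert (verts T) (\<tau> \<union> \<tau>1) = insert (verts T) (\<tau>' \<union> \<tau>1')"
  shows "a = a' \<and> b = b' \<and> \<tau> = \<tau>' \<and> \<tau>1 = \<tau>1'"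
proof -
  interpret c: tree_cut T a b using T ab by unfold_locales
  interpret c': tree_cut T a' b' using T ab by unfold_locales
  \<comment> \<open>Stated for arbitrary decompositions, in order to be applied in both
    directions.\<close>
  have sub: "verts x \<subseteq> verts y"
    if "(x, x1) \<in># cuts T" "(y, y1) \<in># cuts T" "s \<in> Tub x" "s1 \<in> Tub x1" "u \<in> Tub y" "u1 \<in> Tub y1"
      "insert (verts T) (s \<union> s1) = insert (verts T) (u \<union> u1)" for x x1 y y1 s s1 u u1
  proof -
    interpret x: tree_cut T x x1 using T that by unfold_locales
    interpret y: tree_cut T y y1 using T that by unfold_locales
    have "verts x \<in> s" using that(3) by (auto simp: Tub_def binary_tubing_def)
    moreover have "verts x \<noteq> verts T"
      using x.verts_union x.verts_disjoint root_in_verts[of x1] by auto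
    ultimately have "verts x \<in> u \<union> u1" using that(7) by auto
    moreover have "X \<subseteq> verts y" if "X \<in> u" for X
      using that \<open>u \<in> Tub y\<close> by (auto simp: Tub_def binary_tubing_def tube_def)
    moreover have "X \<subseteq> verts y1" if "X \<in> u1" for X
      using that \<open>u1 \<in> Tub y1\<close> by (auto simp: Tub_def binary_tubing_def tube_def)
    moreover have "root T \<in> verts x" "root T \<in> verts y"
      using root_in_verts x.root_upper y.root_upper by metis+
    ultimately show ?thesis using y.verts_disjoint by blast
  qed
  have va: "verts a = verts a'"
    using sub[OF ab \<tau> eq] sub[OF ab(2,1) \<tau>(3,4,1,2) eq[symmetric]] by blast
  hence vb: "verts b = verts b'"
    using c.verts_union c'.verts_union c.verts_disjoint c'.verts_disjoint by blast
  \<comment> \<open>Equal vertex sets give equal lower roots, and these identify the cut, so the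
    trees themselves agree.\<close>
  have "root b = tube_root T (verts b)" "root b' = tube_root T (verts b')"
    using tube_root_eq[OF T] c.rooted_at_parts(2) c'.rooted_at_parts(2) rooted_at_verts by metis+
  hence "(root \<circ> snd) (a, b) = (root \<circ> snd) (a', b')" using vb by simp
  hence "(a, b) = (a', b')" using inj_onD[OF cuts_distinct(1)[OF T]] ab by blast
  moreover have "\<tau> = \<tau>'"
    using c.join_recover(1)[OF \<tau>(1,2)] c'.join_recover(1)[OF \<tau>(3,4)] va eq by simp
  moreover have "\<tau>1 = \<tau>1'"
    using c.join_recover(2)[OF \<tau>(1,2)] c'.join_recover(2)[OF \<tau>(3,4)] vb eq by simp
  ultimately show ?thesis by simp
qed

lemma finite_Tub: "finite (Tub T)"
  by (rule finite_subset[of _ "Pow (Pow (verts T))"])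
     (auto simp: Tub_def binary_tubing_def tube_def finite_verts)

text \<open>Reindexing along the bijection \<open>j\<close>, which forgets the cut:
  \<open>join_cut_unique\<close> gives injectivity, \<open>Tub_split\<close> surjectivity.\<close>

lemma sum_Tub:
  assumes "distinct_verts T" "verts T \<noteq> {root T}"
  shows "(\<Sum>\<sigma>\<in>Tub T. g \<sigma>) =
    (\<Sum>(a, b)\<in>#cuts T. \<Sum>\<tau>\<in>Tub a. \<Sum>\<tau>'\<in>Tub b. g (insert (verts T) (\<tau> \<union> \<tau>')))"
proof -
  define S where "S = Sigma (set_mset (cuts T)) (\<lambda>(a, b). Tub a \<times> Tub b)"
  define j where "j = (\<lambda>(_ :: 'a rtree \<times> 'a rtree, \<tau>, \<tau>'). insert (verts T) (\<tau> \<union> \<tau>'))"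
  have "inj_on j S"
  proof (rule inj_onI)
    fix x y assume "x \<in> S" "y \<in> S" "j x = j y"
    thus "x = y" unfolding S_def j_def
      by (clarsimp simp del: insert_iff) (metis join_cut_unique[OF assms(1)])
  qed
  moreover have "j ` S = Tub T"
  proof
    show "j ` S \<subseteq> Tub T"
      using tree_cut.binary_tubing_join[OF tree_cut.intro[OF assms(1)]] unfolding S_def j_def by auto
    show "Tub T \<subseteq> j ` S"
    proof
      fix \<sigma> assume "\<sigma> \<in> Tub T"
      from Tub_split[OF assms this] obtain a b \<tau> \<tau>' where
        "(a, b) \<in># cuts T" "\<tau> \<in> Tub a" "\<tau>' \<in> Tub b" "\<sigma> = insert (verts T) (\<tau> \<union> \<tau>')" by blast
      hence "((a, b), \<tau>, \<tau>') \<in> S" "\<sigma> = j ((a, b), \<tau>, \<tau>')" unfolding S_def j_def by auto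
      thus "\<sigma> \<in> j ` S" by blast
    qed
  qed
  ultimately have "(\<Sum>\<sigma>\<in>Tub T. g \<sigma>) = (\<Sum>x\<in>S. g (j x))"
    by (metis (no_types, lifting) sum.reindex_cong)
  also have "\<dots> = (\<Sum>x\<in>set_mset (cuts T). \<Sum>y\<in>(case x of (a, b) \<Rightarrow> Tub a \<times> Tub b). g (j (x, y)))"
    unfolding S_def by (subst sum.Sigma) (auto simp: finite_Tub)
  also have "\<dots> = (\<Sum>(a, b)\<in>set_mset (cuts T). \<Sum>\<tau>\<in>Tub a. \<Sum>\<tau>'\<in>Tub b. g (insert (verts T) (\<tau> \<union> \<tau>')))"
    by (rule sum.cong) (auto simp: j_def sum.cartesian_product case_prod_unfold)
  finally show ?thesis by (simp only: cuts_distinct(2)[OF assms(1)])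
qed


subsection \<open>Comparison of the two recursions\<close>

lemma sum_mset_sum_mset: "(\<Sum>x\<in>#(\<Sum>s\<in>#M. N s). f x) = (\<Sum>s\<in>#M. \<Sum>x\<in>#N s. f x)"
  by (induction M) auto

text \<open>In the product rule the term \<open>h s\<close> stands for cutting the edge from the
  root to the branch \<open>s\<close>, which removes the branch. A cut inside \<open>s\<close>
  replaces the branch by its upper part. These are all cuts of \<open>Node v ts\<close>.\<close>

lemma poly_deriv_prod_cuts:
  fixes f :: "'v rtree \<Rightarrow> 'k::comm_ring_1 poly"
  assumes "\<And>s. s \<in># ts \<Longrightarrow> poly_deriv (f s) = [:h s:] + (\<Sum>(a, b)\<in>#cuts s. smult (h b) (f a))"
  shows "poly_deriv (\<Prod>s\<in>#ts. f s) =
    (\<Sum>(a, b)\<in>#cuts (Node v ts). smult (h b) (\<Prod>s\<in>#children a. f s))"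
proof -
  have "poly_deriv (\<Prod>s\<in>#ts. f s) = (\<Sum>s\<in>#ts. poly_deriv (f s) * (\<Prod>u\<in>#ts - {#s#}. f u))"
    by (rule poly_deriv_prod_mset)
  also have "\<dots> = (\<Sum>s\<in>#ts. smult (h s) (\<Prod>u\<in>#ts - {#s#}. f u) +
      (\<Sum>(a, b)\<in>#cuts s. smult (h b) (\<Prod>u\<in>#add_mset a (ts - {#s#}). f u)))"
    by (intro arg_cong[where f = sum_mset] image_mset_cong)
       (simp add: assms distrib_right sum_mset_distrib_right case_prod_unfold)
  also have "\<dots> = (\<Sum>(a, b)\<in>#cuts (Node v ts). smult (h b) (\<Prod>s\<in>#children a. f s))"
    by (simp add: sum_mset_sum_mset image_mset.compositionality comp_def case_prod_unfold)
  finally show ?thesis .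
qed

lemma Lam_sum_mset: "Lam c d (\<Sum>x\<in>#M. f x) = (\<Sum>x\<in>#M. Lam c d (f x))"
  by (induction M) (auto simp: Lam_0 Lam_add)

text \<open>The renormalisation group equation. \<open>poly_deriv_Lam\<close> moves the derivative
  inside \<open>Lam\<close>, where the product rule and the induction hypothesis give the
  cuts.\<close>

lemma poly_deriv_phi_tree:
  fixes c :: "nat \<Rightarrow> 'd \<Rightarrow> 'k::comm_rat_algebra_1" and dec :: "'v \<Rightarrow> 'd"
  defines "\<phi> \<equiv> \<lambda>T. phi_tree c (map_rtree dec T)"
  shows "poly_deriv (\<phi> T) = [:coeff (\<phi> T) 1:] + (\<Sum>(a, b)\<in>#cuts T. smult (coeff (\<phi> b) 1) (\<phi> a))"
proof (induction T)
  case (Node v ts)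
  have \<phi>: "\<phi> (Node v us) = Lam c (dec v) (\<Prod>s\<in>#us. \<phi> s)" for v us
    by (simp add: \<phi>_def image_mset.compositionality comp_def)
  have "poly_deriv (\<phi> (Node v ts)) = [:coeff (\<phi> (Node v ts)) 1:] + Lam c (dec v) (poly_deriv (\<Prod>s\<in>#ts. \<phi> s))"
    unfolding \<phi> by (rule poly_deriv_Lam)
  also have "poly_deriv (\<Prod>s\<in>#ts. \<phi> s) = (\<Sum>(a, b)\<in>#cuts (Node v ts). smult (coeff (\<phi> b) 1) (\<Prod>s\<in>#children a. \<phi> s))"
    by (rule poly_deriv_prod_cuts) (rule Node)
  also have "Lam c (dec v) \<dots> = (\<Sum>(a, b)\<in>#cuts (Node v ts). smult (coeff (\<phi> b) 1) (Lam c (dec v) (\<Prod>s\<in>#children a. \<phi> s)))"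
    by (simp add: Lam_sum_mset case_prod_unfold Lam_smult del: cuts.simps)
  also have "\<dots> = (\<Sum>(a, b)\<in>#cuts (Node v ts). smult (coeff (\<phi> b) 1) (\<phi> a))"
  proof (intro arg_cong[where f = sum_mset] image_mset_cong, clarify)
    fix a b assume "(a, b) \<in># cuts (Node v ts)"
    \<comment> \<open>The upper part keeps the root \<open>v\<close>, so the same operator
      \<open>Lam\<close> rebuilds its polynomial.\<close>
    from cuts_parts(2)[OF this] have "a = Node v (children a)" by (cases a) auto
    thus "smult (coeff (\<phi> b) 1) (Lam c (dec v) (\<Prod>s\<in>#children a. \<phi> s)) = smult (coeff (\<phi> b) 1) (\<phi> a)"
      using \<phi>[of v "children a"] by simp
  qed
  finally show ?case .
qed

section \<open>The generating polynomial of the tubings\<close>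

text \<open>The tube \<open>verts T\<close> is rooted at the root. Hence nothing is lost by the
  truncated subtraction in \<open>tube_count T (root T) \<tau> - 1\<close>.\<close>

lemma tube_count_root_pos:
  assumes "distinct_verts T" "\<tau> \<in> Tub T"
  shows "tube_count T (root T) \<tau> > 0"
proof -
  have "verts T \<in> {X \<in> \<tau>. tube_root T X = root T}"
    using assms tube_root_eq[OF assms(1) rooted_at_verts] by (auto simp: Tub_def binary_tubing_def)
  moreover have "finite \<tau>"
    by (rule finite_subset[of _ "Pow (verts T)"])
       (use assms(2) in \<open>auto simp: Tub_def binary_tubing_def tube_def finite_verts\<close>)
  ultimately show ?thesis unfolding tube_count_def by (auto simp: card_gt_0_iff)
qed

lemma Tub_single:
  assumes "verts T = {v}"
  shows "Tub T = {{{v}}}"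
proof -
  have "tube T {v}" using assms by (auto simp: tube_def)
  hence "binary_tubing T {{v}}" using assms by (auto simp: binary_tubing_def is_singleton_def)
  moreover have "\<tau> = {{v}}" if "binary_tubing T \<tau>" for \<tau>
    using that assms unfolding binary_tubing_def tube_def by (auto simp: subset_singleton_iff)
  ultimately have "binary_tubing T = (\<lambda>\<tau>. \<tau> = {{v}})" by blast
  thus ?thesis by (simp add: Tub_def)
qed

text \<open>The operator of the root decoration is left out; applying it turns this polynomial into
  the right-hand side of the theorem.\<close>

definition tubing_poly :: "(nat \<Rightarrow> 'd \<Rightarrow> 'k::comm_rat_algebra_1) \<Rightarrow> ('v \<Rightarrow> 'd) \<Rightarrow> 'v rtree \<Rightarrow> 'k poly" where
  "tubing_poly c dec T = (\<Sum>\<tau>\<in>Tub T. smult (mellin_monomial c T dec \<tau>)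
     (divided_power (tube_count T (root T) \<tau> - 1)))"

lemma Lam_tubing_poly:
  assumes "distinct_verts T"
  shows "Lam c d (tubing_poly c dec T) = (\<Sum>\<tau>\<in>Tub T. smult (mellin_monomial c T dec \<tau>)
     (mellin_poly c d (tube_count T (root T) \<tau>)))"
  unfolding tubing_poly_def Lam_sum Lam_smult Lam_divided_power
  using tube_count_root_pos[OF assms] by (intro sum.cong) auto

text \<open>The derivative lowers the divided power by one, just as passing to the upper part lowers
  the root count by one. The double sum over \<tau> and \<tau>' then factors.\<close>

lemma poly_deriv_tubing_poly:
  assumes "distinct_verts T" "verts T \<noteq> {root T}"
  shows "poly_deriv (tubing_poly c dec T) =
    (\<Sum>(a, b)\<in>#cuts T. smult (coeff (Lam c (dec (root b)) (tubing_poly c dec b)) 1) (tubing_poly c dec a))"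
proof -
  have "poly_deriv (tubing_poly c dec T) = (\<Sum>(a, b)\<in>#cuts T. \<Sum>\<tau>\<in>Tub a. \<Sum>\<tau>'\<in>Tub b.
      smult (mellin_monomial c T dec (insert (verts T) (\<tau> \<union> \<tau>')))
       (poly_deriv (divided_power (tube_count T (root T) (insert (verts T) (\<tau> \<union> \<tau>')) - 1))))"
    unfolding tubing_poly_def poly_deriv_sum poly_deriv_smult by (rule sum_Tub[OF assms])
  also have "\<dots> = (\<Sum>(a, b)\<in>#cuts T. smult (coeff (Lam c (dec (root b)) (tubing_poly c dec b)) 1) (tubing_poly c dec a))"
  proof (intro arg_cong[where f = sum_mset] image_mset_cong, clarify)
    fix a b assume ab: "(a, b) \<in># cuts T"
    interpret tree_cut T a b using assms ab by unfold_locales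
    \<comment> \<open>The whole contribution of the lower part, including the factor of its
      root.\<close>
    define w where "w \<tau>' = mellin_monomial c b dec \<tau>' * c (tube_count b (root b) \<tau>' - 1) (dec (root b))" for \<tau>'
    have tubes: "\<forall>X\<in>\<tau>. tube a X" if "\<tau> \<in> Tub a" for \<tau>
      using that by (auto simp: Tub_def binary_tubing_def)
    have tubes': "\<forall>X\<in>\<tau>. tube b X" if "\<tau> \<in> Tub b" for \<tau>
      using that by (auto simp: Tub_def binary_tubing_def)
    have "(\<Sum>\<tau>\<in>Tub a. \<Sum>\<tau>'\<in>Tub b.
      smult (mellin_monomial c T dec (insert (verts T) (\<tau> \<union> \<tau>')))
       (poly_deriv (divided_power (tube_count T (root T) (insert (verts T) (\<tau> \<union> \<tau>')) - 1)))) =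
      (\<Sum>\<tau>\<in>Tub a. \<Sum>\<tau>'\<in>Tub b. smult (w \<tau>') (smult (mellin_monomial c a dec \<tau>) (divided_power (tube_count a (root a) \<tau> - 1))))"
    proof (intro sum.cong refl)
      fix \<tau> \<tau>' assume \<tau>: "\<tau> \<in> Tub a" "\<tau>' \<in> Tub b"
      obtain m where m: "tube_count a (root a) \<tau> = Suc m"
        using tube_count_root_pos[OF distinct_parts(1) \<tau>(1)] gr0_implies_Suc by blast
      show "smult (mellin_monomial c T dec (insert (verts T) (\<tau> \<union> \<tau>')))
         (poly_deriv (divided_power (tube_count T (root T) (insert (verts T) (\<tau> \<union> \<tau>')) - 1))) =
        smult (w \<tau>') (smult (mellin_monomial c a dec \<tau>) (divided_power (tube_count a (root a) \<tau> - 1)))"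
        using m tube_count_join(2)[OF tubes[OF \<tau>(1)] tubes'[OF \<tau>(2)]]
          mellin_monomial_join[OF tubes[OF \<tau>(1)] tubes'[OF \<tau>(2)], of c dec]
        by (simp add: root_upper w_def poly_deriv_divided_power_Suc mult_ac)
    qed
    also have "\<dots> = smult (\<Sum>\<tau>'\<in>Tub b. w \<tau>') (tubing_poly c dec a)"
      unfolding tubing_poly_def smult_sum smult_sum_right ..
    \<comment> \<open>The factor of \<open>root b\<close> is the linear coefficient of
      \<open>mellin_poly\<close> at the root count of \<tau>'.\<close>
    also have "(\<Sum>\<tau>'\<in>Tub b. w \<tau>') = coeff (Lam c (dec (root b)) (tubing_poly c dec b)) 1"
      unfolding Lam_tubing_poly[OF distinct_parts(2)] coeff_sum w_def
      by (intro sum.cong refl) (simp add: coeff_1_mellin_poly[unfolded One_nat_def] tube_count_root_pos[OF distinct_parts(2)])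
    finally show "(\<Sum>\<tau>\<in>Tub a. \<Sum>\<tau>'\<in>Tub b.
      smult (mellin_monomial c T dec (insert (verts T) (\<tau> \<union> \<tau>')))
       (poly_deriv (divided_power (tube_count T (root T) (insert (verts T) (\<tau> \<union> \<tau>')) - 1)))) =
       smult (coeff (Lam c (dec (root b)) (tubing_poly c dec b)) 1) (tubing_poly c dec a)" .
  qed
  finally show ?thesis .
qed

text \<open>In a tree with an edge, the root of each tubing carries at least two tubes: the whole
  tree and the upper part. So every divided power has positive index.\<close>

lemma coeff_0_tubing_poly:
  assumes "distinct_verts T" "verts T \<noteq> {root T}"
  shows "coeff (tubing_poly c dec T) 0 = 0"
proof -
  have "coeff (tubing_poly c dec T) 0 = (\<Sum>(a, b)\<in>#cuts T. \<Sum>\<tau>\<in>Tub a. \<Sum>\<tau>'\<in>Tub b.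
      mellin_monomial c T dec (insert (verts T) (\<tau> \<union> \<tau>')) *
       coeff (divided_power (tube_count T (root T) (insert (verts T) (\<tau> \<union> \<tau>')) - 1)) 0)"
    unfolding tubing_poly_def coeff_sum coeff_smult by (rule sum_Tub[OF assms])
  also have "\<dots> = (\<Sum>(a, b)\<in>#cuts T. 0)"
  proof (intro arg_cong[where f = sum_mset] image_mset_cong, clarify, intro sum.neutral ballI)
    fix a b \<tau> \<tau>' assume ab: "(a, b) \<in># cuts T" and \<tau>: "\<tau> \<in> Tub a" "\<tau>' \<in> Tub b"
    interpret tree_cut T a b using assms ab by unfold_locales
    have "\<forall>X\<in>\<tau>. tube a X" "\<forall>X\<in>\<tau>'. tube b X"
      using \<tau> by (auto simp: Tub_def binary_tubing_def)
    from tube_count_join(2)[OF this] tube_count_root_pos[OF distinct_parts(1) \<tau>(1)]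
    show "mellin_monomial c T dec (insert (verts T) (\<tau> \<union> \<tau>')) *
       coeff (divided_power (tube_count T (root T) (insert (verts T) (\<tau> \<union> \<tau>')) - 1)) 0 = 0"
      by (simp add: coeff_divided_power root_upper)
  qed
  finally show ?thesis by (simp add: case_prod_unfold)
qed

lemma coeff_0_prod_mset:
  assumes "M \<noteq> {#}" "\<And>x. x \<in># M \<Longrightarrow> coeff (f x) 0 = 0"
  shows "coeff (\<Prod>x\<in>#M. f x) 0 = 0"
proof -
  obtain x N where "M = add_mset x N" using assms(1) by (meson multiset_cases)
  thus ?thesis using assms(2)[of x] by (simp add: coeff_mult)
qed

section \<open>Agreement of the two polynomials and the formula for the morphism\<close>

text \<open>Strong induction on the number of vertices, since the differential equation involves
  both parts of each cut. For a single vertex both sides are 1.\<close>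

lemma tubing_poly_eq_prod:
  fixes c :: "nat \<Rightarrow> 'd \<Rightarrow> 'k::comm_rat_algebra_1"
  assumes "distinct_verts T"
  shows "tubing_poly c dec T = (\<Prod>s\<in>#children T. phi_tree c (map_rtree dec s))"
  using assms
proof (induction "size (verts_mset T)" arbitrary: T rule: less_induct)
  case less
  define \<phi> where "\<phi> T = phi_tree c (map_rtree dec T)" for T
  have \<phi>: "\<phi> T = Lam c (dec (root T)) (\<Prod>s\<in>#children T. \<phi> s)" for T
    by (cases T) (simp add: \<phi>_def image_mset.compositionality comp_def)
  obtain v ts where T: "T = Node v ts" by (cases T)
  show ?case
  proof (cases "ts = {#}")
    case True
    hence V: "verts T = {v}" and r: "root T = v" using T by simp_all
    have "tube_count T v {{v}} = 1"
    proof -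
      have "tube_root T {v} = v"
        using tube_root_eq[OF less.prems rooted_at_verts] by (simp only: V r)
      hence "{X \<in> {{v}}. tube_root T X = v} = {{v}}" by auto
      thus ?thesis by (simp add: tube_count_def)
    qed
    thus ?thesis using True T V
      by (simp add: tubing_poly_def Tub_single mellin_monomial_def divided_power_0)
  next
    case False
    then obtain s where s: "s \<in># ts" by blast
    have "root s \<noteq> v" using distinct_verts_child(2)[of v ts s] less.prems s T root_in_verts[of s] by auto
    moreover have "root s \<in> verts T" using s T root_in_verts[of s] by auto
    ultimately have V: "verts T \<noteq> {root T}" using T by auto
    have "poly_deriv (tubing_poly c dec T) = (\<Sum>(a, b)\<in>#cuts T. smult (coeff (\<phi> b) 1) (\<Prod>s\<in>#children a. \<phi> s))"
      unfolding poly_deriv_tubing_poly[OF less.prems V]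
    proof (intro arg_cong[where f = sum_mset] image_mset_cong, clarify)
      fix a b assume ab: "(a, b) \<in># cuts T"
      interpret tree_cut T a b using less.prems ab by unfold_locales
      have "size (verts_mset a) > 0" "size (verts_mset b) > 0"
        by (cases a, simp) (cases b, simp)
      hence "size (verts_mset a) < size (verts_mset T)" "size (verts_mset b) < size (verts_mset T)"
        unfolding cuts_parts(1)[OF ab, symmetric] by auto
      hence "tubing_poly c dec a = (\<Prod>s\<in>#children a. \<phi> s)" "tubing_poly c dec b = (\<Prod>s\<in>#children b. \<phi> s)"
        using less.hyps distinct_parts unfolding \<phi>_def by blast+
      thus "smult (coeff (Lam c (dec (root b)) (tubing_poly c dec b)) 1) (tubing_poly c dec a) =
        smult (coeff (\<phi> b) 1) (\<Prod>s\<in>#children a. \<phi> s)"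
        by (simp add: \<phi>[of b])
    qed
    also have "\<dots> = poly_deriv (\<Prod>s\<in>#ts. \<phi> s)"
      unfolding T by (rule poly_deriv_prod_cuts[symmetric]) (unfold \<phi>_def, rule poly_deriv_phi_tree)
    finally have "poly_deriv (tubing_poly c dec T) = poly_deriv (\<Prod>s\<in>#ts. \<phi> s)" .
    \<comment> \<open>There is at least one factor, and each is a value of \<open>Lam\<close>, which
      has no constant term.\<close>
    moreover have "coeff (\<Prod>s\<in>#ts. \<phi> s) 0 = 0"
      by (rule coeff_0_prod_mset[OF False]) (subst \<phi>, rule coeff_0_Lam)
    ultimately have "tubing_poly c dec T = (\<Prod>s\<in>#ts. \<phi> s)"
      using poly_eq_if_poly_deriv_eq coeff_0_tubing_poly[OF less.prems V] by metis
    thus ?thesis by (simp add: T \<phi>_def)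
  qed
qed

theorem theorem4p2:
  fixes c :: "nat \<Rightarrow> 'd \<Rightarrow> 'k::comm_rat_algebra_1"
    and \<phi> :: "('d, 'k) forest_algebra \<Rightarrow> 'k poly"
    and t :: "'d rtree" and T :: "'v rtree" and dec :: "'v \<Rightarrow> 'd"
  assumes "algebra_morphism \<phi>"
    and "\<forall>d. \<phi> \<circ> B_plus d = Lam c d \<circ> \<phi>"
    and "distinct_verts T" and "t = map_rtree dec T"
  shows "\<phi> (forest {#t#}) =
    (\<Sum>\<tau>\<in>Tub T. smult (mellin_monomial c T dec \<tau>)
       (\<Sum>i=1..tube_count T (root T) \<tau>.
          smult (c (tube_count T (root T) \<tau> - i) (dec (root T))) (divided_power i)))"
proof -
  have "\<phi> (forest {#t#}) = phi_tree c t"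
    unfolding mellin_morphism_unique[OF assms(1,2)] forest_def by simp
  also have "\<dots> = Lam c (dec (root T)) (\<Prod>s\<in>#children T. phi_tree c (map_rtree dec s))"
    unfolding assms(4) by (cases T) (simp add: image_mset.compositionality comp_def)
  also have "\<dots> = Lam c (dec (root T)) (tubing_poly c dec T)"
    by (simp only: tubing_poly_eq_prod[OF assms(3)])
  finally show ?thesis
    unfolding Lam_tubing_poly[OF assms(3)] mellin_poly_def .
qed

end
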